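(* Let $h\ge 3$ and $n\ge 2$ be integers and let $O_n$ be the ortho-chain of length $n$ all of whose cycles have $h$ vertices. Then the number of maximum independent sets of $O_n$ is $$\Psi_{\alpha(O_n)}(O_n)=\begin{cases}1, & h\text{ even and } n=2k \text{ for an integer } k,\\[1mm] 2+\dfrac{kh}{2}, & h\text{ even and } n=2k+1 \text{ for an integer } k,\\[2mm] \left(\dfrac{h+1}{2}\right)^2, & h\text{ odd}.\end{cases}$$
   Context: All graphs are finite and simple. $\alpha(G)$ is the independence number of $G$ (largest size of an independent set), a maximum independent set is an independent set of size $\alpha(G)$, and $\Psi_k(G)$ is the number of independent sets of $G$ with exactly $k$ vertices. A cactus is a connected graph in which each edge lies in at most one cycle. A chain cactus is a cactus in which each block is a cycle containing at most two cut vertices and each cut vertex is contained in exactly two cycles; its length is the number of its cycles. A chain $h$-cactus is a chain cactus all of whose cycles have exactly $h$ vertices. In a chain cactus of length $n$ the cycles are denoted $C^{(1)},\dots,C^{(n)}$ in their order along the chain (consecutive cycles share one cut vertex). Internal cycles are $C^{(2)},\dots,C^{(n-1)}$; each contains exactly two cut vertices. An internal cycle is in $k$-position if its two cut vertices are at distance $k$ (in the cycle); $1$-position is called ortho-position. The ortho-chain $O_n$ is the chain $h$-cactus of length $n$ (unique up to isomorphism) all of whose internal cycles are in ortho-position; $O_2$ is two $h$-cycles sharing one vertex. *)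

theory Defs
  imports "Graph_Theory.Graph_Theory"
begin

text \<open>
  A finite simple graph is a \<^locale>\<open>pair_graph\<close>: every undirected edge is represented by its two
  opposite arcs. For symmetric digraphs the predicate \<^const>\<open>connected\<close> is ordinary connectedness; it
  excludes the null graph.
\<close>

definition independent_set :: "'a pair_pre_digraph \<Rightarrow> 'a set \<Rightarrow> bool" where
  "independent_set G S \<longleftrightarrow> S \<subseteq> pverts G \<and> (\<forall>u\<in>S. \<forall>v\<in>S. (u, v) \<notin> parcs G)"

definition independence_number :: "'a pair_pre_digraph \<Rightarrow> nat" where
  "independence_number G = Max (card ` {S. independent_set G S})"

definition num_independent_sets :: "nat \<Rightarrow> 'a pair_pre_digraph \<Rightarrow> nat" where
  "num_independent_sets k G = card {S. independent_set G S \<and> card S = k}"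

text \<open>
  The cycles of a graph, as subgraphs. The library's \<^term>\<open>pre_digraph.cycle\<close> is a rooted, oriented
  closed arc walk, and it admits walks going back and forth along one edge, so its length has to
  be required to be at least three; the subgraph forgets root and orientation.
\<close>

definition cycles :: "'a pair_pre_digraph \<Rightarrow> 'a pair_pre_digraph set" where
  "cycles G = {\<lparr>pverts = fst ` set p, parcs = set p \<union> (set p)\<inverse>\<rparr> | p.
     pre_digraph.cycle (with_proj G) p \<and> 3 \<le> length p}"

text \<open>A cut vertex separates two other vertices of its component.\<close>

definition cut_vertex :: "('a, 'b) pre_digraph \<Rightarrow> 'a \<Rightarrow> bool" where
  "cut_vertex G v \<longleftrightarrow> v \<in> verts G \<and>
     (\<exists>u w. u \<noteq> v \<and> w \<noteq> v \<and> u \<rightarrow>\<^sup>*\<^bsub>G\<^esub> w \<and> \<not> u \<rightarrow>\<^sup>*\<^bsub>pre_digraph.del_vert G v\<^esub> w)"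

text \<open>A block is a maximal connected subgraph that has no cut vertex of its own.\<close>

definition blocks :: "'a pair_pre_digraph \<Rightarrow> 'a pair_pre_digraph set" where
  "blocks G = {B. pre_digraph.max_subgraph (with_proj G)
     (\<lambda>H. graph H \<and> connected H \<and> (\<forall>v. \<not> cut_vertex H v)) (with_proj B)}"

definition cactus :: "'a pair_pre_digraph \<Rightarrow> bool" where
  "cactus G \<longleftrightarrow> pair_graph G \<and> connected (with_proj G) \<and>
     (\<forall>e\<in>parcs G. \<forall>C\<in>cycles G. \<forall>D\<in>cycles G. e \<in> parcs C \<and> e \<in> parcs D \<longrightarrow> C = D)"

definition cut_vertices_on :: "'a pair_pre_digraph \<Rightarrow> 'a pair_pre_digraph \<Rightarrow> 'a set" where
  "cut_vertices_on G C = {v \<in> pverts C. cut_vertex (with_proj G) v}"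

definition chain_cactus :: "'a pair_pre_digraph \<Rightarrow> bool" where
  "chain_cactus G \<longleftrightarrow> cactus G \<and>
     (\<forall>B\<in>blocks G. B \<in> cycles G \<and> card (cut_vertices_on G B) \<le> 2) \<and>
     (\<forall>v. cut_vertex (with_proj G) v \<longrightarrow> card {C \<in> cycles G. v \<in> pverts C} = 2)"

definition chain_h_cactus :: "nat \<Rightarrow> nat \<Rightarrow> 'a pair_pre_digraph \<Rightarrow> bool" where
  "chain_h_cactus h n G \<longleftrightarrow> chain_cactus G \<and> card (cycles G) = n \<and>
     (\<forall>C\<in>cycles G. card (pverts C) = h)"

text \<open>An enumeration \<open>C 1, \<dots>, C n\<close> of the cycles in their order along the chain.\<close>

definition chain_order :: "nat \<Rightarrow> 'a pair_pre_digraph \<Rightarrow> (nat \<Rightarrow> 'a pair_pre_digraph) \<Rightarrow> bool" where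
  "chain_order n G C \<longleftrightarrow> bij_betw C {1..n} (cycles G) \<and>
     (\<forall>i\<in>{1..<n}. \<exists>v. cut_vertex (with_proj G) v \<and> pverts (C i) \<inter> pverts (C (i + 1)) = {v})"

text \<open>With all arc weights equal to one, \<^term>\<open>wf_digraph.\<mu>\<close> is the graph distance.\<close>

definition in_position :: "nat \<Rightarrow> 'a pair_pre_digraph \<Rightarrow> 'a pair_pre_digraph \<Rightarrow> bool" where
  "in_position k G C \<longleftrightarrow> (\<exists>u v. u \<noteq> v \<and> cut_vertices_on G C = {u, v} \<and>
     wf_digraph.\<mu> (with_proj C) (\<lambda>_. 1) u v = ereal (real k))"

definition ortho_chain :: "nat \<Rightarrow> nat \<Rightarrow> 'a pair_pre_digraph \<Rightarrow> bool" where
  "ortho_chain h n G \<longleftrightarrow> chain_h_cactus h n G \<and>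
     (\<exists>C. chain_order n G C \<and> (\<forall>i\<in>{2..n - 1}. in_position 1 G (C i)))"

end

theory Submission
  imports Defs
begin

text \<open>
  Each internal cycle of an ortho-chain has adjacent cut vertices, so once it is known which of
  them are chosen, the remaining freedom is an independent set of a path. A path with \<open>k\<close> vertices
  has a unique maximum independent set if \<open>k\<close> is odd and \<open>k / 2 + 1\<close> of them if \<open>k\<close> is even. Let
  \<open>w\<^sub>i\<close> be the vertex common to the cycles \<open>i\<close> and \<open>i + 1\<close>. The number of largest independent sets
  of the first \<open>i\<close> cycles, counted separately for those which contain \<open>w\<^sub>i\<close> and those which do not,
  then satisfies a two-state recursion in \<open>i\<close>, which depends on the parity of \<open>h\<close> and is solved
  explicitly.

  That the cycles of the graph are really arranged like this follows from the cut vertices: every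
  edge lies in a block, hence in a cycle, and two cycles on different sides of \<open>w\<^sub>i\<close> meet at most
  in \<open>w\<^sub>i\<close>, because otherwise the graph without \<open>w\<^sub>i\<close> would still be connected.
\<close>

section \<open>Counting largest sets\<close>

text \<open>Only the arc relation is a parameter, so the notion applies unchanged to segments,
  single cycles and unions of cycles. On subsets of the vertex set it agrees with
  \<open>independent_set\<close>.\<close>

definition indep :: "'a rel \<Rightarrow> 'a set \<Rightarrow> bool" where
  "indep E S \<longleftrightarrow> (\<forall>u\<in>S. \<forall>v\<in>S. (u, v) \<notin> E)"

text \<open>
  The count \<open>c\<close> may be zero, so \<open>d\<close> is only an upper bound for the sizes. In this form the
  predicate is closed under disjoint unions, products and weakening of \<open>d\<close>.
\<close>

definition top_count :: "'a set set \<Rightarrow> nat \<Rightarrow> nat \<Rightarrow> bool" where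
  "top_count F d c \<longleftrightarrow> finite F \<and> (\<forall>S\<in>F. finite S \<and> card S \<le> d) \<and> card {S \<in> F. card S = d} = c"

lemma top_count_empty: "top_count {} d 0"
  by (simp add: top_count_def)

text \<open>Above the old bound no set attains the new one. This pads families with different
  largest sizes to a common bound before they are added.\<close>

lemma top_count_weaken:
  assumes "top_count F d c" "d < d'"
  shows "top_count F d' 0"
proof -
  have "{S \<in> F. card S = d'} = {}"
    using assms by (fastforce simp: top_count_def)
  then show ?thesis
    using assms by (fastforce simp: top_count_def)
qed

lemma top_count_Un:
  assumes "top_count F d c" "top_count F' d c'" "F \<inter> F' = {}"
  shows "top_count (F \<union> F') d (c + c')"
proof -
  have "{S \<in> F \<union> F'. card S = d} = {S \<in> F. card S = d} \<union> {S \<in> F'. card S = d}"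
    by auto
  moreover have "{S \<in> F. card S = d} \<inter> {S \<in> F'. card S = d} = {}"
    using assms(3) by auto
  ultimately show ?thesis
    using assms by (auto simp: top_count_def card_Un_disjoint)
qed

text \<open>Disjoint supports make the union map injective and sizes additive, and a sum of two
  bounded numbers attains the sum of the bounds only if both attain theirs.\<close>

lemma top_count_prod:
  assumes F: "top_count F d c" "\<And>S. S \<in> F \<Longrightarrow> S \<subseteq> A"
    and F': "top_count F' d' c'" "\<And>R. R \<in> F' \<Longrightarrow> R \<subseteq> B"
    and AB: "A \<inter> B = {}"
  shows "top_count ((\<lambda>(S, R). S \<union> R) ` (F \<times> F')) (d + d') (c * c')"
proof -
  let ?u = "\<lambda>(S, R). S \<union> R"
  have inj: "inj_on ?u (F \<times> F')"
  proof (rule inj_onI, clarify)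
    fix S R S' R' assume "S \<in> F" "R \<in> F'" "S' \<in> F" "R' \<in> F'" and eq: "S \<union> R = S' \<union> R'"
    then have "S \<subseteq> A" "S' \<subseteq> A" "R \<subseteq> B" "R' \<subseteq> B"
      using F F' by auto
    then have "S = (S \<union> R) \<inter> A" "S' = (S' \<union> R') \<inter> A" "R = (S \<union> R) \<inter> B" "R' = (S' \<union> R') \<inter> B"
      using AB by auto
    with eq show "S = S' \<and> R = R'" by metis
  qed
  have card_Un: "card (S \<union> R) = card S + card R" if "S \<in> F" "R \<in> F'" for S R
    using that F F' AB by (intro card_Un_disjoint) (auto simp: top_count_def, blast)
  have top: "card (S \<union> R) = d + d' \<longleftrightarrow> card S = d \<and> card R = d'" if "S \<in> F" "R \<in> F'" for S R
  proof -
    have "card S \<le> d" "card R \<le> d'"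
      using that F(1) F'(1) by (auto simp: top_count_def)
    then show ?thesis using card_Un[OF that] by linarith
  qed
  have eq: "{X \<in> ?u ` (F \<times> F'). card X = d + d'}
      = ?u ` ({S \<in> F. card S = d} \<times> {R \<in> F'. card R = d'})" (is "?l = ?r")
  proof (intro subset_antisym subsetI)
    fix X assume "X \<in> ?l"
    then obtain S R where "X = S \<union> R" "S \<in> F" "R \<in> F'" "card (S \<union> R) = d + d'" by auto
    then show "X \<in> ?r" using top by (auto intro!: image_eqI[where x = "(S, R)"])
  next
    fix X assume "X \<in> ?r"
    then obtain S R where "X = S \<union> R" "S \<in> F" "R \<in> F'" "card S = d" "card R = d'" by auto
    then show "X \<in> ?l" using top by (auto intro!: image_eqI[where x = "(S, R)"])
  qed
  have "card {X \<in> ?u ` (F \<times> F'). card X = d + d'} = c * c'"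
    unfolding eq
    using F(1) F'(1) by (subst card_image) (auto simp: top_count_def intro: inj_on_subset[OF inj])
  then show ?thesis
    using F(1) F'(1) card_Un by (auto simp: top_count_def intro!: add_mono)
qed

lemma top_count_singleton: "finite S \<Longrightarrow> top_count {S} (card S) 1"
  by (simp add: top_count_def conj_commute cong: conj_cong)

lemma top_count_insert:
  assumes "top_count F d c" "\<And>S. S \<in> F \<Longrightarrow> x \<notin> S"
  shows "top_count (insert x ` F) (d + 1) c"
proof -
  have "top_count ((\<lambda>(S, R). S \<union> R) ` (F \<times> {{x}})) (d + 1) (c * 1)"
    using assms top_count_singleton[of "{x}"]
    by (intro top_count_prod[where A = "- {x}" and B = "{x}"]) auto
  also have "(\<lambda>(S, R). S \<union> R) ` (F \<times> {{x}}) = insert x ` F"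
  proof -
    have "F \<times> {{x}} = (\<lambda>S. (S, {x})) ` F" by auto
    then show ?thesis by (simp add: image_image)
  qed
  finally show ?thesis by simp
qed

text \<open>Induction in steps of two vertices, splitting on whether the last vertex is chosen. If
  it is, its predecessor is excluded and the first \<open>k\<close> vertices are free; otherwise the
  first \<open>k + 1\<close> are. The offset \<open>a\<close> is arbitrary because the segments of a
  cycle used later start at index 1 or 2.\<close>

lemma top_count_path:
  fixes a :: int and f :: "int \<Rightarrow> 'a"
  assumes "inj_on f {a..<a + int k}"
    and "\<And>i j. a \<le> i \<Longrightarrow> i < j \<Longrightarrow> j < a + int k \<Longrightarrow> (f i, f j) \<in> E \<longleftrightarrow> j = i + 1"
    and "sym E" "irrefl E"
  shows "top_count {R. R \<subseteq> f ` {a..<a + int k} \<and> indep E R}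
           ((k + 1) div 2) (if odd k then 1 else k div 2 + 1)"
  using assms(1,2)
proof (induction k rule: induct_nat_012)
  case 0
  have "{R. R \<subseteq> f ` {a..<a + int 0} \<and> indep E R} = {{}}"
    by (auto simp: indep_def)
  then show ?case using top_count_singleton[of "{}"] by simp
next
  case 1
  have "{a..<a + int (Suc 0)} = {a}" by auto
  then have "{R. R \<subseteq> f ` {a..<a + int (Suc 0)} \<and> indep E R} = {{}} \<union> {{f a}}"
    using \<open>irrefl E\<close> by (auto simp: indep_def irrefl_def)
  moreover have "top_count {{}} 1 0" "top_count {{f a}} 1 1"
    using top_count_weaken[OF top_count_singleton[of "{}"], of 1] top_count_singleton[of "{f a}"]
    by auto
  ultimately show ?case
    using top_count_Un[of "{{}}" 1 0 "{{f a}}" 1] by auto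
next
  case (ge2 k)
  define x where "x = f (a + int k + 1)"
  let ?P = "\<lambda>k. {R. R \<subseteq> f ` {a..<a + int k} \<and> indep E R}"
  have IH0: "top_count (?P k) ((k + 1) div 2) (if odd k then 1 else k div 2 + 1)"
    using ge2(3,4) by (intro ge2(1)) (auto simp: inj_on_def)
  have IH1: "top_count (?P (Suc k)) ((Suc k + 1) div 2) (if odd (Suc k) then 1 else Suc k div 2 + 1)"
    using ge2(3,4) by (intro ge2(2)) (auto simp: inj_on_def)
  have xk: "x \<notin> f ` {a..<a + int (Suc k)}"
    unfolding x_def by (auto dest: inj_onD[OF ge2(3)])
  have adj: "(f i, x) \<in> E \<longleftrightarrow> i = a + int k" if "a \<le> i" "i < a + int k + 1" for i
    unfolding x_def using that by (subst ge2(4)) auto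
  have adj': "(x, f i) \<in> E \<longleftrightarrow> i = a + int k" if "a \<le> i" "i < a + int k + 1" for i
    using adj[OF that] \<open>sym E\<close> by (meson symD)
  have xx: "(x, x) \<notin> E" using \<open>irrefl E\<close> by (auto simp: irrefl_def)
  have "{a..<a + int (Suc (Suc k))} = insert (a + int k + 1) {a..<a + int (Suc k)}"
    by auto
  then have seg2: "f ` {a..<a + int (Suc (Suc k))} = insert x (f ` {a..<a + int (Suc k)})"
    unfolding x_def by (metis image_insert)
  have "{a..<a + int (Suc k)} = insert (a + int k) {a..<a + int k}"
    by auto
  then have seg1: "f ` {a..<a + int (Suc k)} = insert (f (a + int k)) (f ` {a..<a + int k})"
    by (metis image_insert)
  have ins: "indep E (insert x R) \<longleftrightarrow> indep E R \<and> f (a + int k) \<notin> R"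
    if "R \<subseteq> f ` {a..<a + int (Suc k)}" for R
    using that xx adj adj' by (auto simp: indep_def subset_iff image_iff)
  have split: "?P (Suc (Suc k)) = ?P (Suc k) \<union> insert x ` ?P k" (is "?l = ?r")
  proof (intro subset_antisym subsetI)
    fix R assume R: "R \<in> ?l"
    show "R \<in> ?r"
    proof (cases "x \<in> R")
      case False
      then show ?thesis using R seg2 by auto
    next
      case True
      have "R - {x} \<subseteq> f ` {a..<a + int (Suc k)}" using R seg2 by auto
      moreover have "insert x (R - {x}) = R" using True by auto
      ultimately have "R - {x} \<in> ?P k"
        using ins[of "R - {x}"] R seg1 by auto
      then show ?thesis
        by (intro UnI2 image_eqI[where x = "R - {x}"]) (use \<open>insert x (R - {x}) = R\<close> in simp_all)
    qed
  next
    fix R assume "R \<in> ?r"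
    then show "R \<in> ?l"
    proof
      assume "R \<in> insert x ` ?P k"
      then obtain T where T: "R = insert x T" "T \<in> ?P k" by auto
      have "f (a + int k) \<notin> f ` {a..<a + int k}"
        by (auto dest: inj_onD[OF ge2(3)])
      with T(2) have "T \<subseteq> f ` {a..<a + int (Suc k)}" "f (a + int k) \<notin> T" "indep E T"
        unfolding seg1 by auto
      then show ?thesis unfolding T(1) using ins[of T] seg2 by auto
    qed (use seg2 in auto)
  qed
  have disj: "?P (Suc k) \<inter> insert x ` ?P k = {}" using xk by auto
  have x: "top_count (insert x ` ?P k) ((k + 1) div 2 + 1) (if odd k then 1 else k div 2 + 1)"
    using IH0 xk seg1 by (intro top_count_insert) auto
  show ?case
  proof (cases "odd k")
    case True
    \<comment> \<open>For odd \<open>k\<close> the sets without \<open>x\<close> fall short by one,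
      so only those with \<open>x\<close> count; for even \<open>k\<close> both kinds attain the
      bound, and the counts 1 and \<open>k div 2 + 1\<close> add up.\<close>
    then have "(Suc k + 1) div 2 < (k + 1) div 2 + 1" by (auto elim!: oddE)
    from top_count_Un[OF top_count_weaken[OF IH1 this] x disj]
    show ?thesis
      unfolding split using True by simp
  next
    case False
    then show ?thesis
      unfolding split using IH1 top_count_Un[OF _ x disj, of 1] by (auto elim!: evenE)
  qed
qed

section \<open>Independent sets of paths and cycles\<close>

text \<open>
  Indexing by all integers makes rotation and reflection of a cycle substitutions in the index.
\<close>

definition cyclic_enum :: "'a rel \<Rightarrow> 'a set \<Rightarrow> nat \<Rightarrow> (int \<Rightarrow> 'a) \<Rightarrow> bool" where
  "cyclic_enum E V h f \<longleftrightarrow> range f = V \<and> (\<forall>i j. f i = f j \<longleftrightarrow> int h dvd i - j) \<and>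
     (\<forall>i j. (f i, f j) \<in> E \<longleftrightarrow> int h dvd i - j - 1 \<or> int h dvd j - i - 1)"

lemma cyclic_enum_shift:
  assumes "cyclic_enum E V h f"
  shows "cyclic_enum E V h (\<lambda>i. f (k + i))"
proof -
  have "range f = f ` range (\<lambda>i. k + i)" by (simp only: surj_plus)
  also have "\<dots> = range (\<lambda>i. f (k + i))" by (simp only: image_image)
  finally show ?thesis
    using assms by (simp add: cyclic_enum_def)
qed

lemma cyclic_enum_reflect:
  assumes "cyclic_enum E V h f"
  shows "cyclic_enum E V h (\<lambda>i. f (- i))"
proof -
  have "range f = f ` range uminus" by (simp only: surj_uminus)
  also have "\<dots> = range (\<lambda>i. f (- i))" by (simp only: image_image)
  finally have "range (\<lambda>i. f (- i)) = V"
    using assms by (simp add: cyclic_enum_def)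
  moreover have "f (- i) = f (- j) \<longleftrightarrow> int h dvd i - j" for i j
  proof -
    have "f (- i) = f (- j) \<longleftrightarrow> int h dvd - i - - j"
      using assms unfolding cyclic_enum_def by blast
    then show ?thesis
      using dvd_minus_iff[of "int h" "i - j"] by simp
  qed
  moreover have "(f (- i), f (- j)) \<in> E \<longleftrightarrow> int h dvd i - j - 1 \<or> int h dvd j - i - 1" for i j
  proof -
    have "(f (- i), f (- j)) \<in> E \<longleftrightarrow> int h dvd - i - - j - 1 \<or> int h dvd - j - - i - 1"
      using assms unfolding cyclic_enum_def by blast
    then show ?thesis
      by (simp add: disj_commute add.commute)
  qed
  ultimately show ?thesis
    unfolding cyclic_enum_def by blast
qed

lemma cyclic_enum_from:
  assumes "cyclic_enum E V h f" "u \<in> V"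
  obtains g where "cyclic_enum E V h g" "g 0 = u"
proof -
  obtain k where "u = f k"
    using assms by (auto simp: cyclic_enum_def)
  then show ?thesis
    using that[OF cyclic_enum_shift[OF assms(1), of k]] by simp
qed

text \<open>After rotating \<open>u\<close> to index 0, its neighbour \<open>w\<close> sits at an
  index congruent to -1 or 1 modulo \<open>h\<close>. The first is already \<open>h - 1\<close>; in
  the second case a reflection, which fixes index 0, brings it there.\<close>

lemma cyclic_enum_from_to:
  assumes "cyclic_enum E V h f" "u \<in> V" "w \<in> V" "(u, w) \<in> E"
  obtains g where "cyclic_enum E V h g" "g 0 = u" "g (int h - 1) = w"
proof -
  obtain g where g: "cyclic_enum E V h g" "g 0 = u"
    using cyclic_enum_from assms by metis
  obtain j where j: "w = g j"
    using g assms by (auto simp: cyclic_enum_def)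
  from g assms(4) consider "int h dvd - j - 1" | "int h dvd j - 1"
    unfolding cyclic_enum_def j by (metis diff_0 diff_zero)
  then show ?thesis
  proof cases
    case 1
    then have "int h dvd (- j - 1) + int h" by simp
    then have "int h dvd (int h - 1) - j" by (simp add: algebra_simps)
    then have "g (int h - 1) = w" using g j by (simp add: cyclic_enum_def)
    then show ?thesis using that g by blast
  next
    case 2
    then have "int h dvd (j - 1) + int h" by simp
    then have "int h dvd j - (1 - int h)" by (simp add: algebra_simps)
    then have "g j = g (1 - int h)" using g by (simp add: cyclic_enum_def)
    then have "g (- (int h - 1)) = w" using j by simp
    then show ?thesis
      using that[OF cyclic_enum_reflect[OF g(1)]] g(2) by simp
  qed
qed

text \<open>The flag \<open>b\<close> records whether \<open>u\<close> is chosen; \<open>u\<close> itself is never part of a trace.\<close>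

definition traces :: "'a rel \<Rightarrow> 'a set \<Rightarrow> 'a \<Rightarrow> bool \<Rightarrow> 'a set set" where
  "traces E V u b = {R. R \<subseteq> V - {u} \<and> indep E (if b then insert u R else R)}"

text \<open>Fixing the state of one vertex, or of two adjacent vertices, of an
  \<open>h\<close>-cycle leaves a path with \<open>h - 1\<close>, \<open>h - 2\<close> or
  \<open>h - 3\<close> vertices. The path formulas are restated here by the parity of
  \<open>h\<close>.\<close>

lemma cycle_length_arith:
  assumes "3 \<le> (h :: nat)"
  shows "(h - 3 + 1) div 2 = (h - 2) div 2" "(h - 2 + 1) div 2 = (h - 1) div 2"
    "(h - 3 + 1) div 2 + 1 = h div 2"
    "(if odd (h - 1) then 1 else (h - 1) div 2 + 1) = (if even h then 1 else (h + 1) div 2)"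
    "(if odd (h - 2) then 1 else (h - 2) div 2 + 1) = (if even h then h div 2 else 1)"
    "(if odd (h - 3) then 1 else (h - 3) div 2 + 1) = (if even h then 1 else (h - 1) div 2)"
proof -
  obtain k where "h = k + 3" using assms by (metis le_Suc_ex add.commute)
  then show "(h - 3 + 1) div 2 = (h - 2) div 2" "(h - 2 + 1) div 2 = (h - 1) div 2"
    "(h - 3 + 1) div 2 + 1 = h div 2"
    "(if odd (h - 1) then 1 else (h - 1) div 2 + 1) = (if even h then 1 else (h + 1) div 2)"
    "(if odd (h - 2) then 1 else (h - 2) div 2 + 1) = (if even h then h div 2 else 1)"
    "(if odd (h - 3) then 1 else (h - 3) div 2 + 1) = (if even h then 1 else (h - 1) div 2)"
    by (cases "even k"; auto elim!: evenE oddE)+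
qed

section \<open>Traces of independent sets on one cycle, rooted at index 0\<close>

locale cyclic =
  fixes E :: "'a rel" and V :: "'a set" and h :: nat and f :: "int \<Rightarrow> 'a"
  assumes h3: "3 \<le> h" and symE: "sym E" and irreflE: "irrefl E"
    and enum: "cyclic_enum E V h f"
begin

lemma f_eq_iff: "f i = f j \<longleftrightarrow> int h dvd i - j"
  using enum by (auto simp: cyclic_enum_def)

lemma f_eq_window:
  assumes "\<bar>i - j\<bar> < int h"
  shows "f i = f j \<longleftrightarrow> i = j"
  using assms dvd_imp_le_int[of "i - j" "int h"] by (force simp: f_eq_iff)

lemma inj_on_window: "b - a \<le> int h \<Longrightarrow> inj_on f {a..<b}"
  by (auto intro!: inj_onI simp: f_eq_window)

text \<open>Within one period the congruences modulo \<open>h\<close> become equations; the second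
  alternative is the closing edge of the cycle.\<close>

lemma adj_window:
  assumes "i < j" "j < i + int h"
  shows "(f i, f j) \<in> E \<longleftrightarrow> j = i + 1 \<or> j = i + int h - 1"
proof -
  have "int h dvd j - i - 1 \<longleftrightarrow> j = i + 1"
    using assms dvd_imp_le_int[of "j - i - 1" "int h"] by force
  moreover have "int h dvd i - j - 1 \<longleftrightarrow> j = i + int h - 1"
  proof
    assume "int h dvd i - j - 1"
    then have "int h dvd (i - j - 1) + int h" by simp
    then show "j = i + int h - 1"
      using assms dvd_imp_le_int[of "(i - j - 1) + int h" "int h"] h3 by force
  qed auto
  ultimately show ?thesis
    using enum by (auto simp: cyclic_enum_def)
qed

lemma V_eq: "V = f ` {a..<a + int h}"
proof -
  have "f i \<in> f ` {a..<a + int h}" for i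
  proof -
    have "f i = f (a + (i - a) mod int h)"
      by (simp add: f_eq_iff mod_eq_dvd_iff[symmetric] mod_simps)
    then show ?thesis
      using h3 by (auto intro!: image_eqI[where x = "a + (i - a) mod int h"])
  qed
  then show ?thesis
    using enum by (auto simp: cyclic_enum_def)
qed

lemma V_minus: "V - {f 0} = f ` {1..<int h}"
proof -
  have "{0..<int h} = insert 0 {1..<int h}"
    using h3 by auto
  then have "V = insert (f 0) (f ` {1..<int h})"
    using V_eq[of 0] by simp
  moreover have "f 0 \<notin> f ` {1..<int h}"
    by (auto simp: f_eq_window)
  ultimately show ?thesis by auto
qed

text \<open>Fewer than \<open>h\<close> consecutive vertices do not contain both ends of the closing
  edge of the window, so they induce a path.\<close>

lemma top_count_segment:
  assumes "int k < int h"
  shows "top_count {R. R \<subseteq> f ` {a..<a + int k} \<and> indep E R}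
           ((k + 1) div 2) (if odd k then 1 else k div 2 + 1)"
  using assms by (intro top_count_path symE irreflE inj_on_window) (auto simp: adj_window)

lemma indep_insert: "indep E (insert x R) \<longleftrightarrow> indep E R \<and> (\<forall>y\<in>R. (x, y) \<notin> E)"
  using symE irreflE by (auto simp: indep_def irrefl_def dest: symD)

lemma traces_False: "traces E V (f 0) False = {R. R \<subseteq> f ` {1..<1 + int (h - 1)} \<and> indep E R}"
  using h3 by (simp add: traces_def V_minus)

lemma nonneighbours:
  assumes "R \<subseteq> f ` {1..<int h}"
  shows "(\<forall>y\<in>R. (f 0, y) \<notin> E) \<longleftrightarrow> R \<subseteq> f ` {2..<int h - 1}"
proof -
  have "f i \<in> f ` {2..<int h - 1} \<longleftrightarrow> i \<in> {2..<int h - 1}" if "1 \<le> i" "i < int h" for i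
    using that by (subst inj_on_image_mem_iff[OF inj_on_window[of "int h" 1]]) auto
  moreover have "(f 0, f i) \<notin> E \<longleftrightarrow> i \<in> {2..<int h - 1}" if "1 \<le> i" "i < int h" for i
    using that by (subst adj_window) auto
  ultimately have *: "(f 0, f i) \<notin> E \<longleftrightarrow> f i \<in> f ` {2..<int h - 1}" if "1 \<le> i" "i < int h" for i
    using that by simp
  have "(f 0, y) \<notin> E \<longleftrightarrow> y \<in> f ` {2..<int h - 1}" if "y \<in> R" for y
  proof -
    have "y \<in> f ` {1..<int h}" using assms that by (rule subsetD)
    then obtain i where i: "y = f i" "1 \<le> i" "i < int h" by auto
    show ?thesis unfolding i(1) by (rule *[OF i(2,3)])
  qed
  then show ?thesis unfolding subset_eq by (rule ball_cong[OF refl])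
qed

text \<open>Apart from \<open>f 0\<close>, which lies outside the range considered, the only
  neighbour of the last vertex is the one at index \<open>h - 2\<close>.\<close>

lemma nonneighbours_last:
  assumes "R \<subseteq> f ` {1..<int h - 1}"
  shows "(\<forall>y\<in>R. (f (int h - 1), y) \<notin> E) \<longleftrightarrow> R \<subseteq> f ` {1..<int h - 2}"
proof -
  have "f i \<in> f ` {1..<int h - 2} \<longleftrightarrow> i \<in> {1..<int h - 2}" if "1 \<le> i" "i < int h - 1" for i
    using that by (subst inj_on_image_mem_iff[OF inj_on_window[of "int h" 1]]) auto
  moreover have "(f (int h - 1), f i) \<notin> E \<longleftrightarrow> i \<in> {1..<int h - 2}" if "1 \<le> i" "i < int h - 1" for i
  proof -
    have "(f (int h - 1), f i) \<in> E \<longleftrightarrow> (f i, f (int h - 1)) \<in> E"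
      using symE by (auto dest: symD)
    then show ?thesis
      using that by (simp add: adj_window) linarith
  qed
  ultimately have *: "(f (int h - 1), f i) \<notin> E \<longleftrightarrow> f i \<in> f ` {1..<int h - 2}" if "1 \<le> i" "i < int h - 1" for i
    using that by simp
  have "(f (int h - 1), y) \<notin> E \<longleftrightarrow> y \<in> f ` {1..<int h - 2}" if "y \<in> R" for y
  proof -
    have "y \<in> f ` {1..<int h - 1}" using assms that by (rule subsetD)
    then obtain i where i: "y = f i" "1 \<le> i" "i < int h - 1" by auto
    show ?thesis unfolding i(1) by (rule *[OF i(2,3)])
  qed
  then show ?thesis unfolding subset_eq by (rule ball_cong[OF refl])
qed

text \<open>Choosing \<open>f 0\<close> excludes its two neighbours, at indices 1 and
  \<open>h - 1\<close>; a path with \<open>h - 3\<close> vertices remains.\<close>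

lemma traces_True: "traces E V (f 0) True = {R. R \<subseteq> f ` {2..<2 + int (h - 3)} \<and> indep E R}"
proof -
  have *: "2 + int (h - 3) = int h - 1" using h3 by simp
  have sub: "f ` {2..<int h - 1} \<subseteq> f ` {1..<int h}" by auto
  show ?thesis
    unfolding * traces_def V_minus if_True indep_insert
    using sub nonneighbours by (intro Collect_cong) (meson subset_trans)
qed

lemma last_notin: "f (int h - 1) \<notin> f ` {1..<int h - 1}"
  by (auto simp: f_eq_window)

lemma seg_last: "f ` {1..<int h} = insert (f (int h - 1)) (f ` {1..<int h - 1})"
proof -
  have "{1..<int h} = insert (int h - 1) {1..<int h - 1}" using h3 by auto
  then show ?thesis by (metis image_insert)
qed

text \<open>The vertex at index \<open>h - 1\<close> plays the role of the next cut vertex. With it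
  and \<open>f 0\<close> both left out, a path with \<open>h - 2\<close> vertices remains.\<close>

lemma traces_False_out:
  "{R \<in> traces E V (f 0) False. f (int h - 1) \<notin> R} = {R. R \<subseteq> f ` {1..<1 + int (h - 2)} \<and> indep E R}"
proof -
  have "1 + int (h - 2) = int h - 1" using h3 by simp
  then show ?thesis
    using last_notin by (auto simp: traces_def V_minus seg_last)
qed

text \<open>Choosing the last vertex also excludes index \<open>h - 2\<close>, so a path with
  \<open>h - 3\<close> vertices is free.\<close>

lemma traces_False_in:
  "{R \<in> traces E V (f 0) False. f (int h - 1) \<in> R} =
     insert (f (int h - 1)) ` {R. R \<subseteq> f ` {1..<1 + int (h - 3)} \<and> indep E R}" (is "?l = ?r")
proof -
  let ?w = "f (int h - 1)"
  have *: "1 + int (h - 3) = int h - 2" using h3 by simp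
  have sub: "f ` {1..<int h - 2} \<subseteq> f ` {1..<int h - 1}" by auto
  show ?thesis
  proof (intro subset_antisym subsetI)
    fix R assume R: "R \<in> ?l"
    then have eq: "R = insert ?w (R - {?w})" by auto
    have s: "R - {?w} \<subseteq> f ` {1..<int h - 1}"
      using R by (auto simp: traces_def V_minus seg_last)
    have "indep E (insert ?w (R - {?w}))"
      using R eq by (simp add: traces_def)
    then have "indep E (R - {?w})" "R - {?w} \<subseteq> f ` {1..<int h - 2}"
      unfolding indep_insert nonneighbours_last[OF s] by auto
    then show "R \<in> ?r" unfolding * by (subst eq) blast
  next
    fix R assume "R \<in> ?r"
    then obtain T where T: "R = insert ?w T" "T \<subseteq> f ` {1..<int h - 2}" "indep E T"
      unfolding * by blast
    then have s: "T \<subseteq> f ` {1..<int h - 1}" using sub by blast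
    then have "indep E R"
      using T by (simp add: indep_insert nonneighbours_last)
    then show "R \<in> ?l"
      using T(1) s by (auto simp: traces_def V_minus seg_last)
  qed
qed

text \<open>This is where adjacency of the two cut vertices shows: they cannot both be chosen, so
  choosing \<open>f 0\<close> decides the state of the other one.\<close>

lemma traces_True_out: "{R \<in> traces E V (f 0) True. f (int h - 1) \<notin> R} = traces E V (f 0) True"
  and traces_True_in: "{R \<in> traces E V (f 0) True. f (int h - 1) \<in> R} = {}"
proof -
  have "f (int h - 1) \<notin> R" if "R \<subseteq> f ` {2..<2 + int (h - 3)}" for R
  proof -
    have "f ` {2..<2 + int (h - 3)} \<subseteq> f ` {1..<int h - 1}" using h3 by auto
    then show ?thesis using that last_notin by blast
  qed
  then show "{R \<in> traces E V (f 0) True. f (int h - 1) \<notin> R} = traces E V (f 0) True"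
    "{R \<in> traces E V (f 0) True. f (int h - 1) \<in> R} = {}"
    unfolding traces_True by auto
qed

lemma top_count_traces_False:
  "top_count (traces E V (f 0) False) (h div 2) (if even h then 1 else (h + 1) div 2)"
  using top_count_segment[of "h - 1" 1] h3 cycle_length_arith[OF h3] unfolding traces_False by simp

lemma top_count_traces_True:
  "top_count (traces E V (f 0) True) ((h - 2) div 2) (if even h then 1 else (h - 1) div 2)"
  using top_count_segment[of "h - 3" 2] h3 cycle_length_arith[OF h3] unfolding traces_True by simp

lemma top_count_traces_False_out:
  "top_count {R \<in> traces E V (f 0) False. f (int h - 1) \<notin> R}
     ((h - 1) div 2) (if even h then h div 2 else 1)"
  using top_count_segment[of "h - 2" 1] h3 cycle_length_arith[OF h3] unfolding traces_False_out by simp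

lemma top_count_traces_False_in:
  "top_count {R \<in> traces E V (f 0) False. f (int h - 1) \<in> R}
     (h div 2) (if even h then 1 else (h - 1) div 2)"
proof -
  have "f ` {1..<1 + int (h - 3)} \<subseteq> f ` {1..<int h - 1}" using h3 by auto
  then have "top_count (insert (f (int h - 1)) ` {R. R \<subseteq> f ` {1..<1 + int (h - 3)} \<and> indep E R})
      ((h - 3 + 1) div 2 + 1) (if odd (h - 3) then 1 else (h - 3) div 2 + 1)"
    using h3 last_notin by (intro top_count_insert top_count_segment) auto
  then show ?thesis
    unfolding traces_False_in cycle_length_arith(3,6)[OF h3] .
qed

end

section \<open>Gluing cycles along cut vertices\<close>

text \<open>Here \<open>v\<close> counts towards the size if it is chosen, in contrast to
  \<open>traces\<close>; joining one set of each kind thus counts the shared vertex once.\<close>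

definition indep_in :: "'a rel \<Rightarrow> 'a set \<Rightarrow> 'a \<Rightarrow> bool \<Rightarrow> 'a set set" where
  "indep_in E U v b = {S. S \<subseteq> U \<and> indep E S \<and> (v \<in> S \<longleftrightarrow> b)}"

text \<open>No edge crosses between the two parts, so once the state of the shared vertex
  \<open>v\<close> is fixed, independence is checked on each part separately. The predicate
  \<open>P\<close> sees only the new part; it later records the state of the next cut
  vertex.\<close>

lemma indep_in_glue:
  assumes UV: "U \<inter> V = {v}"
    and E: "\<And>x y. (x, y) \<in> E \<Longrightarrow> x \<in> U \<union> V \<Longrightarrow> y \<in> U \<union> V \<Longrightarrow> x \<in> U \<and> y \<in> U \<or> x \<in> V \<and> y \<in> V"
    and P: "\<And>S R. S \<subseteq> U \<Longrightarrow> R \<subseteq> V - {v} \<Longrightarrow> P (S \<union> R) \<longleftrightarrow> P R"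
  shows "{S \<in> indep_in E (U \<union> V) v b. P S} =
    (\<lambda>(S, R). S \<union> R) ` (indep_in E U v b \<times> {R \<in> traces E V v b. P R})" (is "?l = ?r")
proof (intro subset_antisym subsetI)
  fix X assume X: "X \<in> ?l"
  then have eq: "X \<inter> U \<union> X \<inter> (V - {v}) = X"
    using UV by (auto simp: indep_in_def)
  have "P (X \<inter> U \<union> X \<inter> (V - {v})) \<longleftrightarrow> P (X \<inter> (V - {v}))"
    by (rule P) auto
  then have "P (X \<inter> (V - {v}))"
    using X eq by simp
  moreover have "(if b then insert v (X \<inter> (V - {v})) else X \<inter> (V - {v})) \<subseteq> X"
    using X by (auto simp: indep_in_def)
  then have "X \<inter> (V - {v}) \<in> traces E V v b"
    using X unfolding indep_in_def traces_def indep_def by blast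
  moreover have "X \<inter> U \<in> indep_in E U v b"
    using X UV by (auto simp: indep_in_def indep_def)
  ultimately have "(X \<inter> U, X \<inter> (V - {v})) \<in> indep_in E U v b \<times> {R \<in> traces E V v b. P R}"
    by blast
  then show "X \<in> ?r"
    using eq by (metis (no_types, lifting) case_prod_conv image_eqI)
next
  fix X assume "X \<in> ?r"
  then obtain S R where X: "X = S \<union> R" and S: "S \<subseteq> U" "indep E S" "v \<in> S \<longleftrightarrow> b"
    and R: "R \<subseteq> V - {v}" "indep E (if b then insert v R else R)" "P R"
    by (auto simp: indep_in_def traces_def)
  have "(x, y) \<notin> E" if "x \<in> S \<union> R" "y \<in> S \<union> R" for x y
  proof
    assume "(x, y) \<in> E"
    moreover have "x \<in> U \<union> V" "y \<in> U \<union> V" using that S R by auto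
    ultimately consider "x \<in> U" "y \<in> U" | "x \<in> V" "y \<in> V" using E by blast
    then show False
    proof cases
      case 1
      then have "x \<in> S" "y \<in> S" using that R UV by auto
      then show False using S \<open>(x, y) \<in> E\<close> by (auto simp: indep_def)
    next
      case 2
      then have "x \<in> (if b then insert v R else R)" "y \<in> (if b then insert v R else R)"
        using that S UV by auto
      then show False using R \<open>(x, y) \<in> E\<close> unfolding indep_def by blast
    qed
  qed
  then show "X \<in> ?l"
    using X S R P[OF S(1) R(1)] by (auto simp: indep_in_def indep_def)
qed

text \<open>Both states of \<open>v\<close> are padded to the common bound \<open>d\<close>; a state
  contributes to the count exactly when its own bound equals \<open>d\<close>.\<close>

lemma top_count_glue:
  assumes UV: "U \<inter> V = {v}"
    and E: "\<And>x y. (x, y) \<in> E \<Longrightarrow> x \<in> U \<union> V \<Longrightarrow> y \<in> U \<union> V \<Longrightarrow> x \<in> U \<and> y \<in> U \<or> x \<in> V \<and> y \<in> V"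
    and P: "\<And>S R. S \<subseteq> U \<Longrightarrow> R \<subseteq> V - {v} \<Longrightarrow> P (S \<union> R) \<longleftrightarrow> P R"
    and False: "top_count (indep_in E U v False) d0 c0"
      "top_count {R \<in> traces E V v False. P R} d0' c0'"
    and True: "top_count (indep_in E U v True) d1 c1"
      "top_count {R \<in> traces E V v True. P R} d1' c1'"
    and d: "d0 + d0' \<le> d" "d1 + d1' \<le> d"
  shows "top_count {S. S \<subseteq> U \<union> V \<and> indep E S \<and> P S} d
    ((if d0 + d0' = d then c0 * c0' else 0) + (if d1 + d1' = d then c1 * c1' else 0))"
proof -
  have glue: "top_count {S \<in> indep_in E (U \<union> V) v b. P S} (e + e') (c * c')"
    if "top_count (indep_in E U v b) e c" "top_count {R \<in> traces E V v b. P R} e' c'" for b e e' c c'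
  proof -
    have "{S \<in> indep_in E (U \<union> V) v b. P S} =
        (\<lambda>(S, R). S \<union> R) ` (indep_in E U v b \<times> {R \<in> traces E V v b. P R})"
      by (intro indep_in_glue UV) ((erule (2) E) | (erule (1) P))+
    moreover have "S \<subseteq> U" if "S \<in> indep_in E U v b" for S
      using that by (simp add: indep_in_def)
    moreover have "R \<subseteq> V - {v}" if "R \<in> {R \<in> traces E V v b. P R}" for R
      using that by (simp add: traces_def)
    moreover have "U \<inter> (V - {v}) = {}" using UV by blast
    ultimately show ?thesis
      using top_count_prod[OF that(1) _ that(2), of U "V - {v}"] by presburger
  qed
  have F: "top_count {S \<in> indep_in E (U \<union> V) v False. P S} d (if d0 + d0' = d then c0 * c0' else 0)"
    using glue[OF False] top_count_weaken[OF glue[OF False], of d] d by auto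
  have T: "top_count {S \<in> indep_in E (U \<union> V) v True. P S} d (if d1 + d1' = d then c1 * c1' else 0)"
    using glue[OF True] top_count_weaken[OF glue[OF True], of d] d by auto
  have "{S. S \<subseteq> U \<union> V \<and> indep E S \<and> P S} =
      {S \<in> indep_in E (U \<union> V) v False. P S} \<union> {S \<in> indep_in E (U \<union> V) v True. P S}"
    by (auto simp: indep_in_def)
  moreover have "{S \<in> indep_in E (U \<union> V) v False. P S} \<inter> {S \<in> indep_in E (U \<union> V) v True. P S} = {}"
    by (auto simp: indep_in_def)
  ultimately show ?thesis
    using top_count_Un[OF F T] by simp
qed

section \<open>Transfer recursion along a chain of cycles\<close>

locale ortho_chain_structure =
  fixes E :: "'a rel" and h n :: nat and V :: "nat \<Rightarrow> 'a set" and w :: "nat \<Rightarrow> 'a"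
  assumes h3: "3 \<le> h" and n2: "2 \<le> n" and symE: "sym E" and irreflE: "irrefl E"
    and enum: "\<And>i. i \<in> {1..n} \<Longrightarrow> \<exists>f. cyclic_enum E (V i) h f"
    and consecutive: "\<And>i. 1 \<le> i \<Longrightarrow> i < n \<Longrightarrow> V i \<inter> V (Suc i) = {w i}"
    and apart: "\<And>i j. 1 \<le> i \<Longrightarrow> Suc i < j \<Longrightarrow> j \<le> n \<Longrightarrow> V i \<inter> V j = {}"
    and edge_in_cycle: "\<And>x y. (x, y) \<in> E \<Longrightarrow> \<exists>i\<in>{1..n}. x \<in> V i \<and> y \<in> V i"
    and ortho: "\<And>i. 2 \<le> i \<Longrightarrow> i < n \<Longrightarrow> (w (i - 1), w i) \<in> E"
begin

definition initial :: "nat \<Rightarrow> 'a set" where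
  "initial i = (\<Union>j\<in>{1..i}. V j)"

lemma initial_Suc: "initial (Suc i) = initial i \<union> V (Suc i)"
  by (auto simp: initial_def atLeastAtMostSuc_conv)

lemma initial_1: "initial 1 = V 1"
  by (simp add: initial_def)

lemma initial_Int: "1 \<le> i \<Longrightarrow> i < n \<Longrightarrow> initial i \<inter> V (Suc i) = {w i}"
proof -
  assume i: "1 \<le> i" "i < n"
  have "V j \<inter> V (Suc i) \<subseteq> {w i}" if "j \<in> {1..i}" for j
    using that i consecutive[of i] apart[of j "Suc i"] by (cases "j = i") auto
  then show ?thesis
    using i consecutive[of i] unfolding initial_def by fastforce
qed

text \<open>The edge lies in some cycle \<open>j\<close>. If \<open>j\<close> came after
  \<open>Suc i\<close>, both ends would lie in the one-point intersection of cycle \<open>j\<close>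
  with the earlier cycles, and the edge would be a loop.\<close>

lemma initial_edges:
  assumes "1 \<le> i" "i < n" "(x, y) \<in> E" "x \<in> initial (Suc i)" "y \<in> initial (Suc i)"
  shows "x \<in> initial i \<and> y \<in> initial i \<or> x \<in> V (Suc i) \<and> y \<in> V (Suc i)"
proof -
  obtain j where j: "1 \<le> j" "j \<le> n" "x \<in> V j" "y \<in> V j"
    using edge_in_cycle[OF assms(3)] by auto
  have "x \<noteq> y" using assms(3) irreflE by (auto simp: irrefl_def)
  have "j \<le> Suc i"
  proof (rule ccontr)
    assume "\<not> j \<le> Suc i"
    have "initial (Suc i) \<subseteq> initial (j - 1)"
      using \<open>\<not> j \<le> Suc i\<close> by (force simp: initial_def)
    then have "x \<in> initial (j - 1) \<inter> V (Suc (j - 1))" "y \<in> initial (j - 1) \<inter> V (Suc (j - 1))"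
      using assms j \<open>\<not> j \<le> Suc i\<close> by auto
    moreover have "initial (j - 1) \<inter> V (Suc (j - 1)) = {w (j - 1)}"
      using \<open>\<not> j \<le> Suc i\<close> assms(1) j by (intro initial_Int) auto
    ultimately show False
      using \<open>x \<noteq> y\<close> by (metis singletonD)
  qed
  then show ?thesis
    using j by (cases "j = Suc i") (auto simp: initial_def)
qed

lemma w_mem: "1 \<le> i \<Longrightarrow> i < n \<Longrightarrow> w i \<in> V i \<and> w i \<in> V (Suc i)"
  using consecutive[of i] by auto

text \<open>Otherwise it would coincide with \<open>w i\<close>, to which it is adjacent. Hence the
  state of the next cut vertex depends on the newly added cycle alone, as gluing requires.\<close>

lemma w_Suc_notin: "1 \<le> i \<Longrightarrow> Suc i < n \<Longrightarrow> w (Suc i) \<notin> initial i"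
proof
  assume i: "1 \<le> i" "Suc i < n" and "w (Suc i) \<in> initial i"
  then have "w (Suc i) \<in> initial i \<inter> V (Suc i)" using w_mem[of "Suc i"] by auto
  then have "w (Suc i) = w i" using initial_Int[of i] i by auto
  then show False
    using ortho[of "Suc i"] i irreflE by (auto simp: irrefl_def)
qed

text \<open>Since the cut vertices are adjacent, the cycle can be enumerated with \<open>w i\<close>
  at index 0 and \<open>w (Suc i)\<close> at index \<open>h - 1\<close>. The last family is empty,
  so every bound \<open>d\<close> is valid for it.\<close>

lemma top_count_internal:
  assumes i: "1 \<le> i" "Suc i < n"
  shows "top_count {R \<in> traces E (V (Suc i)) (w i) False. w (Suc i) \<notin> R}
      ((h - 1) div 2) (if even h then h div 2 else 1)"
    "top_count {R \<in> traces E (V (Suc i)) (w i) False. w (Suc i) \<in> R}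
      (h div 2) (if even h then 1 else (h - 1) div 2)"
    "top_count {R \<in> traces E (V (Suc i)) (w i) True. w (Suc i) \<notin> R}
      ((h - 2) div 2) (if even h then 1 else (h - 1) div 2)"
    "top_count {R \<in> traces E (V (Suc i)) (w i) True. w (Suc i) \<in> R} d 0"
proof -
  obtain f where f: "cyclic_enum E (V (Suc i)) h f" using enum[of "Suc i"] i by auto
  have "w i \<in> V (Suc i)" "w (Suc i) \<in> V (Suc i)" "(w i, w (Suc i)) \<in> E"
    using w_mem[of i] w_mem[of "Suc i"] ortho[of "Suc i"] i by auto
  with f obtain g where g: "cyclic_enum E (V (Suc i)) h g" "g 0 = w i" "g (int h - 1) = w (Suc i)"
    using cyclic_enum_from_to by metis
  interpret cyclic E "V (Suc i)" h g
    using h3 symE irreflE g by unfold_locales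
  show "top_count {R \<in> traces E (V (Suc i)) (w i) False. w (Suc i) \<notin> R}
      ((h - 1) div 2) (if even h then h div 2 else 1)"
    unfolding g(2,3)[symmetric] by (rule top_count_traces_False_out)
  show "top_count {R \<in> traces E (V (Suc i)) (w i) False. w (Suc i) \<in> R}
      (h div 2) (if even h then 1 else (h - 1) div 2)"
    unfolding g(2,3)[symmetric] by (rule top_count_traces_False_in)
  show "top_count {R \<in> traces E (V (Suc i)) (w i) True. w (Suc i) \<notin> R}
      ((h - 2) div 2) (if even h then 1 else (h - 1) div 2)"
    unfolding g(2,3)[symmetric] traces_True_out by (rule top_count_traces_True)
  show "top_count {R \<in> traces E (V (Suc i)) (w i) True. w (Suc i) \<in> R} d 0"
    unfolding g(2,3)[symmetric] traces_True_in by (rule top_count_empty)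
qed

lemma top_count_end:
  assumes "i \<in> {1..n}" "u \<in> V i"
  shows "top_count (traces E (V i) u False) (h div 2) (if even h then 1 else (h + 1) div 2)"
    "top_count (traces E (V i) u True) ((h - 2) div 2) (if even h then 1 else (h - 1) div 2)"
proof -
  obtain g where g: "cyclic_enum E (V i) h g" "g 0 = u"
    using enum cyclic_enum_from assms by metis
  interpret cyclic E "V i" h g
    using h3 symE irreflE g by unfold_locales
  show "top_count (traces E (V i) u False) (h div 2) (if even h then 1 else (h + 1) div 2)"
    "top_count (traces E (V i) u True) ((h - 2) div 2) (if even h then 1 else (h - 1) div 2)"
    using top_count_traces_False top_count_traces_True g by auto
qed

lemma top_count_first:
  "top_count (indep_in E (initial 1) (w 1) False) (h div 2) (if even h then 1 else (h + 1) div 2)"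
  "top_count (indep_in E (initial 1) (w 1) True) (h div 2) (if even h then 1 else (h - 1) div 2)"
proof -
  have w: "w 1 \<in> V 1" using w_mem[of 1] n2 by auto
  have "indep_in E (initial 1) (w 1) False = traces E (V 1) (w 1) False"
    unfolding indep_in_def initial_1 traces_def by auto
  then show "top_count (indep_in E (initial 1) (w 1) False) (h div 2) (if even h then 1 else (h + 1) div 2)"
    using top_count_end(1)[of 1 "w 1"] w n2 by simp
  have "indep_in E (initial 1) (w 1) True = insert (w 1) ` traces E (V 1) (w 1) True" (is "?l = ?r")
  proof (intro subset_antisym subsetI)
    fix S assume S: "S \<in> ?l"
    then have "S = insert (w 1) (S - {w 1})" by (auto simp: indep_in_def)
    moreover have "S - {w 1} \<in> traces E (V 1) (w 1) True"
      using S unfolding indep_in_def initial_1 traces_def indep_def by auto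
    ultimately show "S \<in> ?r" by blast
  next
    fix S assume "S \<in> ?r"
    then show "S \<in> ?l" using w unfolding indep_in_def initial_1 traces_def by auto
  qed
  moreover have "top_count (insert (w 1) ` traces E (V 1) (w 1) True)
      ((h - 2) div 2 + 1) (if even h then 1 else (h - 1) div 2)"
    using w n2 by (intro top_count_insert top_count_end) (auto simp: traces_def)
  moreover have "(h - 2) div 2 + 1 = h div 2" using h3 by linarith
  ultimately show "top_count (indep_in E (initial 1) (w 1) True) (h div 2) (if even h then 1 else (h - 1) div 2)"
    by simp
qed

text \<open>The two-state recursion. In the first claim \<open>d\<close> is left open because the
  parity of \<open>h\<close> decides which previous state is larger. In the second only the state
  without \<open>w i\<close> contributes, as \<open>w i\<close> and \<open>w (Suc i)\<close> are
  adjacent.\<close>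

lemma top_count_step:
  assumes i: "1 \<le> i" "Suc i < n"
    and F: "top_count (indep_in E (initial i) (w i) False) d0 c0"
    and T: "top_count (indep_in E (initial i) (w i) True) d1 c1"
  shows "d0 + (h - 1) div 2 \<le> d \<Longrightarrow> d1 + (h - 2) div 2 \<le> d \<Longrightarrow>
      top_count (indep_in E (initial (Suc i)) (w (Suc i)) False) d
      ((if d0 + (h - 1) div 2 = d then c0 * (if even h then h div 2 else 1) else 0) +
       (if d1 + (h - 2) div 2 = d then c1 * (if even h then 1 else (h - 1) div 2) else 0))"
    and "d1 \<le> d0 + h div 2 \<Longrightarrow>
      top_count (indep_in E (initial (Suc i)) (w (Suc i)) True) (d0 + h div 2)
       (c0 * (if even h then 1 else (h - 1) div 2))"
proof -
  have Int: "initial i \<inter> V (Suc i) = {w i}" using i initial_Int[of i] by simp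
  have edges: "x \<in> initial i \<and> y \<in> initial i \<or> x \<in> V (Suc i) \<and> y \<in> V (Suc i)"
    if "(x, y) \<in> E" "x \<in> initial i \<union> V (Suc i)" "y \<in> initial i \<union> V (Suc i)" for x y
    using initial_edges[of i x y, unfolded initial_Suc] that i by simp
  have fam: "{S. S \<subseteq> initial i \<union> V (Suc i) \<and> indep E S \<and> w (Suc i) \<notin> S} =
      indep_in E (initial (Suc i)) (w (Suc i)) False"
    "{S. S \<subseteq> initial i \<union> V (Suc i) \<and> indep E S \<and> w (Suc i) \<in> S} =
      indep_in E (initial (Suc i)) (w (Suc i)) True"
    by (simp_all add: indep_in_def initial_Suc)
  show "top_count (indep_in E (initial (Suc i)) (w (Suc i)) False) d
      ((if d0 + (h - 1) div 2 = d then c0 * (if even h then h div 2 else 1) else 0) +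
       (if d1 + (h - 2) div 2 = d then c1 * (if even h then 1 else (h - 1) div 2) else 0))"
    if "d0 + (h - 1) div 2 \<le> d" "d1 + (h - 2) div 2 \<le> d"
    unfolding fam[symmetric]
    by (rule top_count_glue[OF Int _ _ F top_count_internal(1)[OF i] T top_count_internal(3)[OF i] that])
      ((erule (2) edges) | use w_Suc_notin[OF i] in blast)+
  show "top_count (indep_in E (initial (Suc i)) (w (Suc i)) True) (d0 + h div 2)
       (c0 * (if even h then 1 else (h - 1) div 2))" if "d1 \<le> d0 + h div 2"
  proof -
    \<comment> \<open>The empty family of traces with both cut vertices is taken with bound 0 and
      count 0, so its term vanishes even when the sizes agree.\<close>
    have "top_count {S. S \<subseteq> initial i \<union> V (Suc i) \<and> indep E S \<and> w (Suc i) \<in> S} (d0 + h div 2)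
      ((if d0 + h div 2 = d0 + h div 2 then c0 * (if even h then 1 else (h - 1) div 2) else 0) +
       (if d1 + 0 = d0 + h div 2 then c1 * 0 else 0))"
      by (rule top_count_glue[OF Int _ _ F top_count_internal(2)[OF i] T top_count_internal(4)[OF i]])
        ((erule (2) edges) | use w_Suc_notin[OF i] that in force)+
    then show ?thesis unfolding fam by (simp only: mult_0_right if_cancel add_0_right refl if_True)
  qed
qed

text \<open>The last cycle has no further cut vertex to track, so the gluing predicate is
  trivial.\<close>

lemma top_count_final:
  assumes i: "1 \<le> i" "Suc i = n"
    and F: "top_count (indep_in E (initial i) (w i) False) d0 c0"
    and T: "top_count (indep_in E (initial i) (w i) True) d1 c1"
    and d: "d0 + h div 2 \<le> d" "d1 + (h - 2) div 2 \<le> d"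
  shows "top_count {S. S \<subseteq> initial n \<and> indep E S} d
      ((if d0 + h div 2 = d then c0 * (if even h then 1 else (h + 1) div 2) else 0) +
       (if d1 + (h - 2) div 2 = d then c1 * (if even h then 1 else (h - 1) div 2) else 0))"
proof -
  have Int: "initial i \<inter> V (Suc i) = {w i}" using i initial_Int[of i] by simp
  have edges: "x \<in> initial i \<and> y \<in> initial i \<or> x \<in> V (Suc i) \<and> y \<in> V (Suc i)"
    if "(x, y) \<in> E" "x \<in> initial i \<union> V (Suc i)" "y \<in> initial i \<union> V (Suc i)" for x y
    using initial_edges[of i x y, unfolded initial_Suc] that i by simp
  have w: "w i \<in> V (Suc i)" using w_mem[of i] i by simp
  have "top_count {S. S \<subseteq> initial i \<union> V (Suc i) \<and> indep E S \<and> True} d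
      ((if d0 + h div 2 = d then c0 * (if even h then 1 else (h + 1) div 2) else 0) +
       (if d1 + (h - 2) div 2 = d then c1 * (if even h then 1 else (h - 1) div 2) else 0))"
  proof (rule top_count_glue[where P = "\<lambda>_. True", OF Int _ _ F _ T _ d])
    show "top_count {R \<in> traces E (V (Suc i)) (w i) False. True} (h div 2) (if even h then 1 else (h + 1) div 2)"
      "top_count {R \<in> traces E (V (Suc i)) (w i) True. True} ((h - 2) div 2) (if even h then 1 else (h - 1) div 2)"
      using top_count_end[of "Suc i" "w i"] w i by simp_all
  qed (use edges in auto)
  moreover have "initial n = initial i \<union> V (Suc i)"
    using initial_Suc[of i] i(2) by simp
  ultimately show ?thesis by (simp only: simp_thms)
qed

text \<open>The behaviour alternates. After an odd number of cycles both states have the same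
  largest size; after an even number the state with the cut vertex is ahead by one. The larger count
  grows by \<open>p + 1\<close>, half of \<open>h\<close>, every two cycles, and passes from one
  state to the other.\<close>

lemma even_top_counts:
  assumes p: "h = 2 * p + 2"
  shows "2 * j + 1 < n \<Longrightarrow>
      top_count (indep_in E (initial (2 * j + 1)) (w (2 * j + 1)) False) ((2 * j + 1) * p + j + 1) 1 \<and>
      top_count (indep_in E (initial (2 * j + 1)) (w (2 * j + 1)) True)
        ((2 * j + 1) * p + j + 1) (j * (p + 1) + 1)" (is "_ \<Longrightarrow> ?odd j")
    and "2 * j + 2 < n \<Longrightarrow>
      top_count (indep_in E (initial (2 * j + 2)) (w (2 * j + 2)) False)
        ((2 * j + 2) * p + j + 1) ((j + 1) * (p + 1) + 1) \<and>
      top_count (indep_in E (initial (2 * j + 2)) (w (2 * j + 2)) True) ((2 * j + 2) * p + j + 2) 1"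
      (is "_ \<Longrightarrow> ?even j")
proof -
  have div: "h div 2 = p + 1" "(h - 1) div 2 = p" "(h - 2) div 2 = p" "even h = True"
    using p by auto
  \<comment> \<open>Equal sizes: both previous states contribute to the new state without the cut
    vertex, with \<open>p + 1\<close> and \<open>j * (p + 1) + 1\<close> sets.\<close>
  have odd_even: "?even j" if "?odd j" "2 * j + 2 < n" for j
  proof
    have i: "1 \<le> 2 * j + 1" "Suc (2 * j + 1) < n" using that by auto
    note step = top_count_step[OF i conjunct1[OF that(1)] conjunct2[OF that(1)], unfolded div if_True]
    show "top_count (indep_in E (initial (2 * j + 2)) (w (2 * j + 2)) False)
        ((2 * j + 2) * p + j + 1) ((j + 1) * (p + 1) + 1)"
      using step(1)[of "(2 * j + 2) * p + j + 1"] by (simp add: algebra_simps)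
    show "top_count (indep_in E (initial (2 * j + 2)) (w (2 * j + 2)) True) ((2 * j + 2) * p + j + 2) 1"
      using step(2) by (simp add: algebra_simps)
  qed
  \<comment> \<open>Here the state with the cut vertex is ahead, so it alone feeds the new state
    without it, while the large count moves to the new state with it.\<close>
  have even_odd: "?odd (Suc j)" if "?even j" "2 * j + 3 < n" for j
  proof
    have i: "1 \<le> 2 * j + 2" "Suc (2 * j + 2) < n" using that by auto
    note step = top_count_step[OF i conjunct1[OF that(1)] conjunct2[OF that(1)], unfolded div if_True]
    have eq: "2 * Suc j + 1 = Suc (2 * j + 2)" by simp
    show "top_count (indep_in E (initial (2 * Suc j + 1)) (w (2 * Suc j + 1)) False)
        ((2 * Suc j + 1) * p + Suc j + 1) 1"
      unfolding eq using step(1)[of "(2 * j + 3) * p + j + 2"] by (simp add: algebra_simps)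
    show "top_count (indep_in E (initial (2 * Suc j + 1)) (w (2 * Suc j + 1)) True)
        ((2 * Suc j + 1) * p + Suc j + 1) (Suc j * (p + 1) + 1)"
      unfolding eq using step(2) by (simp add: algebra_simps)
  qed
  show odd: "?odd j" if "2 * j + 1 < n" for j
    using that
  proof (induction j)
    case 0
    show ?case using top_count_first div by simp
  next
    case (Suc j)
    then show ?case using odd_even even_odd by simp
  qed
  show "?even j" if "2 * j + 2 < n"
    using odd_even[OF odd] that by simp
qed

text \<open>Both states always have the same largest size, and continuing from a chosen cut vertex
  loses one vertex. The count \<open>c\<close> therefore never enters later counts and may stay
  unspecified.\<close>

lemma odd_top_counts:
  assumes p: "h = 2 * p + 3" and "1 \<le> i" "i < n"
  shows "\<exists>c. top_count (indep_in E (initial i) (w i) False) (i * (p + 1)) (p + 2) \<and>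
    top_count (indep_in E (initial i) (w i) True) (i * (p + 1)) c"
  using assms(2,3)
proof (induction i rule: nat_induct_at_least)
  case base
  have "h div 2 = 1 * (p + 1)" "(h + 1) div 2 = p + 2" "even h = False"
    using p by auto
  then show ?case
    using top_count_first unfolding if_False by metis
next
  case (Suc i)
  then obtain c where "top_count (indep_in E (initial i) (w i) False) (i * (p + 1)) (p + 2)"
    "top_count (indep_in E (initial i) (w i) True) (i * (p + 1)) c" by auto
  note step = top_count_step[OF Suc(1,3) this]
  have div: "h div 2 = p + 1" "(h - 1) div 2 = p + 1" "(h - 2) div 2 = p" "even h = False"
    using p by auto
  have eq: "i * (p + 1) + (p + 1) = Suc i * (p + 1)" "(i * (p + 1) + p = Suc i * (p + 1)) = False"
    by auto
  have "top_count (indep_in E (initial (Suc i)) (w (Suc i)) False) (Suc i * (p + 1)) (p + 2)"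
    using step(1)[of "Suc i * (p + 1)", unfolded div eq if_False] by simp
  moreover have "top_count (indep_in E (initial (Suc i)) (w (Suc i)) True) (Suc i * (p + 1))
      ((p + 2) * (p + 1))"
    using step(2)[unfolded div eq if_False] by simp
  ultimately show ?case by (intro exI conjI)
qed

lemma top_count_chain:
  obtains d where "top_count {S. S \<subseteq> initial n \<and> indep E S} d
    (if odd h then ((h + 1) div 2)\<^sup>2 else if even n then 1 else 2 + n div 2 * (h div 2))"
proof -
  consider (odd) p where "h = 2 * p + 3"
    | (even_even) p j where "h = 2 * p + 2" "n = 2 * j + 2"
    | (even_odd) p j where "h = 2 * p + 2" "n = 2 * j + 3"
  proof (cases "odd h")
    case True
    then obtain k where "h = 2 * k + 1" by (elim oddE)
    then have "h = 2 * (k - 1) + 3" using h3 by simp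
    then show thesis using that(1) by blast
  next
    case False
    then obtain k where "h = 2 * k" by auto
    then have k: "h = 2 * (k - 1) + 2" using h3 by simp
    show thesis
    proof (cases "even n")
      case True
      then obtain j where "n = 2 * j" by auto
      then have "n = 2 * (j - 1) + 2" using n2 by simp
      then show thesis using that(2) k by blast
    next
      case False
      then obtain j where "n = 2 * j + 1" by (elim oddE)
      then have "n = 2 * (j - 1) + 3" using n2 by simp
      then show thesis using that(3) k by blast
    qed
  qed
  then show ?thesis
  proof cases
    case odd
    obtain i where i: "n = Suc i" "1 \<le> i" using n2 by (cases n) auto
    from odd_top_counts[OF odd, of i] i obtain c
      where "top_count (indep_in E (initial i) (w i) False) (i * (p + 1)) (p + 2)"
        "top_count (indep_in E (initial i) (w i) True) (i * (p + 1)) c" by auto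
    note final = top_count_final[OF i(2) i(1)[symmetric] this]
    have d: "h div 2 = p + 1" "(h + 1) div 2 = p + 2" "(h - 2) div 2 = p" "even h = False"
      using odd by auto
    \<comment> \<open>Only sets avoiding the last cut vertex are largest: \<open>p + 2\<close> on
      the initial part times \<open>p + 2\<close> on the last cycle.\<close>
    have eq: "(i * (p + 1) + p = i * (p + 1) + (p + 1)) = False" by simp
    show ?thesis
      using final[of "i * (p + 1) + (p + 1)", unfolded d eq if_False] odd
        that[of "i * (p + 1) + (p + 1)"]
      unfolding d by (simp add: power2_eq_square)
  next
    case even_even
    have d: "h div 2 = p + 1" "(h - 2) div 2 = p" "even h = True" "even n = True"
      using even_even by auto
    have "2 * j + 1 < n" using even_even by simp
    \<comment> \<open>At equal sizes the last cycle favours the state without the cut vertex, whose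
      count is 1.\<close>
    note counts = even_top_counts(1)[OF even_even(1) this]
    note final = top_count_final[OF _ _ conjunct1[OF counts] conjunct2[OF counts], unfolded d if_True]
    show ?thesis
      using final[of "(2 * j + 1) * p + j + 1 + (p + 1)"] even_even(2)
        that[of "(2 * j + 1) * p + j + 1 + (p + 1)"] unfolding d by simp
  next
    case even_odd
    have d: "h div 2 = p + 1" "(h - 2) div 2 = p" "even h = True" "even n = False" "n div 2 = j + 1"
      using even_odd by auto
    have "2 * j + 2 < n" using even_odd by simp
    \<comment> \<open>The lead of one vertex compensates the loss in the last cycle, so both states
      contribute: \<open>(j + 1) * (p + 1) + 1\<close> and 1.\<close>
    note counts = even_top_counts(2)[OF even_odd(1) this]
    note final = top_count_final[OF _ _ conjunct1[OF counts] conjunct2[OF counts], unfolded d if_True]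
    show ?thesis
      using final[of "(2 * j + 2) * p + j + 1 + (p + 1)"] even_odd(2)
        that[of "(2 * j + 2) * p + j + 1 + (p + 1)"] unfolding d by simp
  qed
qed

end

section \<open>Cycles of a graph\<close>

lemma pcas_nth:
  assumes "pcas u p v" "i < length p"
  shows "fst (p ! i) = (if i = 0 then u else snd (p ! (i - 1)))"
  using assms
proof (induction p arbitrary: u i)
  case (Cons e p)
  show ?case
  proof (cases i)
    case (Suc j)
    then have "fst (p ! j) = (if j = 0 then snd e else snd (p ! (j - 1)))"
      using Cons by auto
    then show ?thesis using Suc by (cases j) auto
  qed (use Cons in auto)
qed simp

lemma pcas_last: "pcas u p v \<Longrightarrow> p \<noteq> [] \<Longrightarrow> snd (last p) = v"
  by (induction p arbitrary: u) (auto split: if_splits)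

text \<open>The vertices are listed as the heads of the arcs of the closed walk, with the index read
  modulo its length.\<close>

lemma (in pair_wf_digraph) cycle_enum:
  assumes "C \<in> cycles G"
  obtains f where "cyclic_enum (parcs C) (pverts C) (card (pverts C)) f" "3 \<le> card (pverts C)"
proof -
  obtain p u where p: "C = \<lparr>pverts = fst ` set p, parcs = set p \<union> (set p)\<inverse>\<rparr>"
    and len: "3 \<le> length p" and walk: "awalk u p u" and dist: "distinct (tl (awalk_verts u p))"
    using assms by (auto simp: cycles_def cycle_def)
  define h where "h = length p"
  have h: "0 < int h" using len unfolding h_def by linarith
  define f where "f i = snd (p ! nat (i mod int h))" for i
  have cas: "pcas u p u" using walk by (simp add: awalk_def)
  have "awalk_verts u p = u # map snd p"
    using awalk_verts_conv'[of u p u] cas len by (cases p) (auto simp: awalk_verts_conv)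
  \<comment> \<open>Dropping the repeated start vertex \<open>u\<close> from the vertex list leaves
    exactly the heads of the arcs.\<close>
  then have dist: "distinct (map snd p)" using dist by simp
  have nat_mod: "nat (i mod int h) < length p" for i
    using h by (simp add: h_def nat_less_iff)
  have f_eq: "f i = f j \<longleftrightarrow> int h dvd i - j" for i j
  proof -
    have "f i = f j \<longleftrightarrow> nat (i mod int h) = nat (j mod int h)"
      using nth_eq_iff_index_eq[OF dist, of "nat (i mod int h)" "nat (j mod int h)"] nat_mod
      by (simp add: f_def)
    also have "\<dots> \<longleftrightarrow> i mod int h = j mod int h"
      using h by (simp add: eq_nat_nat_iff)
    also have "\<dots> \<longleftrightarrow> int h dvd i - j" by (rule mod_eq_dvd_iff)
    finally show ?thesis .
  qed
  have nth: "p ! k = (f (int k - 1), f (int k))" if "k < h" for k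
  proof -
    have "fst (p ! k) = f (int k - 1)"
    proof (cases "k = 0")
      case True
      \<comment> \<open>Index -1 wraps around to the last arc, whose head is the start
        vertex.\<close>
      have "f (- 1) = f (int (h - 1))"
        using h by (simp add: f_eq of_nat_diff)
      also have "\<dots> = snd (last p)"
        using h by (simp add: f_def last_conv_nth h_def)
      finally show ?thesis
        using True pcas_nth[OF cas, of 0] pcas_last[OF cas] that by (auto simp: h_def)
    next
      case False
      then have k: "int k - 1 = int (k - 1)" by simp
      have "f (int (k - 1)) = snd (p ! (k - 1))"
        using that by (simp add: f_def flip: zmod_int)
      then show ?thesis
        unfolding k using False pcas_nth[OF cas, of k] that by (simp add: h_def)
    qed
    moreover have "snd (p ! k) = f (int k)"
      using that by (simp add: f_def h_def)
    ultimately show ?thesis by (simp add: prod_eq_iff)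
  qed
  have arc: "(f (i - 1), f i) \<in> set p" for i
  proof -
    have "int h dvd i - int (nat (i mod int h))"
      using h by (simp add: mod_eq_dvd_iff[symmetric])
    then have "f i = f (int (nat (i mod int h)))" "f (i - 1) = f (int (nat (i mod int h)) - 1)"
      by (simp_all add: f_eq)
    then show ?thesis
      using nth[of "nat (i mod int h)"] nat_mod[of i] by (metis h_def nth_mem)
  qed
  have arcs: "(f i, f j) \<in> set p \<longleftrightarrow> int h dvd j - i - 1" for i j
  proof
    assume "(f i, f j) \<in> set p"
    then obtain k where "k < h" "f i = f (int k - 1)" "f j = f (int k)"
      using nth by (auto simp: in_set_conv_nth h_def)
    then have "int h dvd i - (int k - 1)" "int h dvd j - int k" by (simp_all only: f_eq)
    then have "int h dvd (j - int k) - (i - (int k - 1))" by (rule dvd_diff[rotated])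
    then show "int h dvd j - i - 1" by (simp add: algebra_simps)
  next
    assume "int h dvd j - i - 1"
    then have "f i = f (j - 1)"
      using f_eq[of "j - 1" i] by (simp add: algebra_simps)
    then show "(f i, f j) \<in> set p" using arc by simp
  qed
  have range: "range f = pverts C"
  proof -
    have "f i \<in> fst ` set p" for i
      using arc[of "i + 1"] by (force simp: image_iff)
    moreover have "fst e \<in> range f" if "e \<in> set p" for e
      using that nth by (auto simp: in_set_conv_nth h_def)
    ultimately show ?thesis by (auto simp: p)
  qed
  have "pverts C = f ` int ` {..<h}"
  proof -
    have "f i \<in> f ` int ` {..<h}" for i
    proof -
      have "f i = f (int (nat (i mod int h)))"
        using h by (simp add: f_eq mod_eq_dvd_iff[symmetric])
      moreover have "nat (i mod int h) \<in> {..<h}" using nat_mod[of i] by (simp add: h_def)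
      ultimately show ?thesis by (metis imageI)
    qed
    then show ?thesis unfolding range[symmetric] by blast
  qed
  moreover have "inj_on f (int ` {..<h})"
    using dist by (auto simp: inj_on_def f_def h_def distinct_conv_nth)
  ultimately have card: "card (pverts C) = h"
    by (simp add: card_image)
  show ?thesis
  proof (rule that)
    show "3 \<le> card (pverts C)" using len card h_def by simp
    show "cyclic_enum (parcs C) (pverts C) (card (pverts C)) f"
      unfolding cyclic_enum_def card using range f_eq arcs by (auto simp: p)
  qed
qed

text \<open>The arc relation need not be symmetric in this locale, while cycles are symmetrised;
  hence the disjunction.\<close>

lemma (in pair_wf_digraph) cycles_subset:
  assumes "C \<in> cycles G"
  shows "pverts C \<subseteq> pverts G" "sym (parcs C)" "(a, b) \<in> parcs C \<Longrightarrow> (a, b) \<in> parcs G \<or> (b, a) \<in> parcs G"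
proof -
  obtain p u where p: "C = \<lparr>pverts = fst ` set p, parcs = set p \<union> (set p)\<inverse>\<rparr>" "awalk u p u"
    using assms by (auto simp: cycles_def cycle_def)
  then have "set p \<subseteq> parcs G" by (simp add: awalk_def)
  then show "pverts C \<subseteq> pverts G" "(a, b) \<in> parcs C \<Longrightarrow> (a, b) \<in> parcs G \<or> (b, a) \<in> parcs G"
    using p in_arcsD1 by force+
  show "sym (parcs C)" using p by (auto simp: sym_def)
qed

section \<open>Reachability after deletion of a vertex\<close>

definition reach_avoiding :: "'a pair_pre_digraph \<Rightarrow> 'a \<Rightarrow> 'a \<Rightarrow> 'a \<Rightarrow> bool" where
  "reach_avoiding G v a b \<longleftrightarrow> a \<rightarrow>\<^sup>*\<^bsub>pre_digraph.del_vert (with_proj G) v\<^esub> b"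

context pair_graph
begin

lemma reach_avoiding_refl: "a \<in> pverts G \<Longrightarrow> a \<noteq> v \<Longrightarrow> reach_avoiding G v a a"
  unfolding reach_avoiding_def
  by (rule wf_digraph.reachable_refl[OF wf_digraph_del_vert]) (simp add: verts_del_vert)

lemma reach_avoiding_trans: "reach_avoiding G v a b \<Longrightarrow> reach_avoiding G v b c \<Longrightarrow> reach_avoiding G v a c"
  unfolding reach_avoiding_def by (rule wf_digraph.reachable_trans[OF wf_digraph_del_vert])

lemma arcs_ends_del_vert: "arcs_ends (pre_digraph.del_vert (with_proj G) v) = {(a, b) \<in> parcs G. a \<noteq> v \<and> b \<noteq> v}"
  by (auto simp: arcs_ends_conv del_vert_simps)

lemma reach_avoiding_adj: "(a, b) \<in> parcs G \<Longrightarrow> a \<noteq> v \<Longrightarrow> b \<noteq> v \<Longrightarrow> reach_avoiding G v a b"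
  unfolding reach_avoiding_def
  by (rule wf_digraph.reachable_adjI[OF wf_digraph_del_vert]) (simp add: arcs_ends_del_vert)

lemma reach_avoiding_sym: "reach_avoiding G v a b \<Longrightarrow> reach_avoiding G v b a"
  unfolding reach_avoiding_def
proof (rule symmetric_reachable)
  show "symmetric (pre_digraph.del_vert (with_proj G) v)"
    unfolding symmetric_def arcs_ends_del_vert by (auto intro!: symI arcs_symmetric)
qed

text \<open>A cycle stays connected when one vertex is deleted: what remains is a path, or the whole
  cycle if the vertex is not on it.\<close>

lemma cycle_reach_avoiding:
  assumes C: "C \<in> cycles G" and a: "a \<in> pverts C" "a \<noteq> v" and b: "b \<in> pverts C" "b \<noteq> v"
  shows "reach_avoiding G v a b"
proof -
  define h where "h = card (pverts C)"
  obtain f where f: "cyclic_enum (parcs C) (pverts C) h f" and h: "3 \<le> h"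
    using cycle_enum[OF C] h_def by metis
  have arcsC: "(x, y) \<in> parcs G" if "(x, y) \<in> parcs C" for x y
    using cycles_subset(3)[OF C that] arcs_symmetric by blast
  \<comment> \<open>Both cases yield a window starting at index 1: \<open>N\<close> is
    \<open>h\<close> if \<open>v\<close> sits at index 0, and \<open>1 + h\<close> if
    \<open>v\<close> is off the cycle.\<close>
  obtain g N where g: "cyclic_enum (parcs C) (pverts C) h g" and N: "pverts C - {v} = g ` {1..<N}"
  proof (cases "v \<in> pverts C")
    case True
    then obtain g where g: "cyclic_enum (parcs C) (pverts C) h g" "g 0 = v"
      using cyclic_enum_from[OF f] by metis
    interpret cyclic "parcs C" "pverts C" h g
      using h g cycles_subset(2)[OF C] arcsC no_loops' by unfold_locales (auto simp: irrefl_def)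
    show ?thesis using that g V_minus by metis
  next
    case False
    interpret cyclic "parcs C" "pverts C" h f
      using h f cycles_subset(2)[OF C] arcsC no_loops' by unfold_locales (auto simp: irrefl_def)
    show ?thesis using that f V_eq[of 1] False by simp
  qed
  have ne: "g i \<noteq> v" "g i \<in> pverts G" if "1 \<le> i" "i < N" for i
  proof -
    have "g i \<in> pverts C - {v}" unfolding N using that by auto
    then show "g i \<noteq> v" "g i \<in> pverts G" using cycles_subset(1)[OF C] by auto
  qed
  have reach: "i < N \<Longrightarrow> reach_avoiding G v (g 1) (g i)" if "1 \<le> i" for i
    using that
  proof (induction i rule: int_ge_induct)
    case base
    then show ?case using ne reach_avoiding_refl by auto
  next
    case (step i)
    have "(g i, g (i + 1)) \<in> parcs C"
      using g by (simp add: cyclic_enum_def)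
    then have "reach_avoiding G v (g i) (g (i + 1))"
      using step ne[of i] ne[of "i + 1"] by (intro reach_avoiding_adj arcsC) auto
    then show ?case using step reach_avoiding_trans by auto
  qed
  have "a \<in> g ` {1..<N}" "b \<in> g ` {1..<N}" using a b N by blast+
  then obtain i j where "a = g i" "1 \<le> i" "i < N" "b = g j" "1 \<le> j" "j < N" by auto
  then show ?thesis
    using reach reach_avoiding_sym reach_avoiding_trans by metis
qed

end

section \<open>The structure of ortho-chains\<close>

text \<open>By finiteness, among the admissible subgraphs containing \<open>H\<close> there is one
  with the most vertices and arcs together. A proper extension would have more, so this one is a
  block.\<close>

lemma (in pair_graph) subgraph_in_block:
  assumes H: "subgraph H (with_proj G)" "graph H" "connected H" "\<And>v. \<not> cut_vertex H v"
  shows "\<exists>B\<in>blocks G. verts H \<subseteq> pverts B \<and> arcs H \<subseteq> parcs B"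
proof -
  let ?P = "\<lambda>K. graph K \<and> connected K \<and> (\<forall>v. \<not> cut_vertex K v)"
  define Q where "Q K \<longleftrightarrow> subgraph K (with_proj G) \<and> ?P K \<and> subgraph H K" for K
  define m where "m K = card (verts K) + card (arcs K)" for K :: "('a, 'a \<times> 'a) pre_digraph"
  have QH: "Q H"
    using H unfolding Q_def by (auto simp: subgraph_def compatible_def)
  have bound: "m K < Suc (card (pverts G) + card (parcs G))" if "Q K" for K
  proof -
    have "verts K \<subseteq> pverts G" "arcs K \<subseteq> parcs G"
      using that by (auto simp: Q_def subgraph_def)
    then show ?thesis
      unfolding m_def using pair_finite_verts pair_finite_arcs
      by (simp add: add_mono card_mono less_Suc_eq_le)
  qed
  obtain K where K: "Q K" "\<And>L. Q L \<Longrightarrow> m L \<le> m K"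
    using ex_has_greatest_nat[of Q H m, OF QH] bound by blast
  define B where "B = \<lparr>pverts = verts K, parcs = arcs K\<rparr>"
  have fst_snd: "tail L = fst" "head L = snd" if "subgraph L (with_proj G)" for L
    using that by (auto simp: subgraph_def compatible_def)
  have B: "with_proj B = K"
    using K fst_snd[of K] by (auto simp: B_def with_proj_def Q_def intro: pre_digraph.equality)
  have "max_subgraph ?P K"
    unfolding max_subgraph_def
  proof (intro conjI allI impI notI)
    fix L assume L: "L \<noteq> K \<and> subgraph K L" "subgraph L (with_proj G) \<and> ?P L"
    have "subgraph H L"
      using K(1) L by (auto simp: Q_def subgraph_def compatible_def)
    then have "Q L" using L by (simp add: Q_def)
    then have le: "m L \<le> m K" by (rule K(2))
    have sub: "verts K \<subseteq> verts L" "arcs K \<subseteq> arcs L"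
      using L by (auto simp: subgraph_def)
    have fin: "finite (verts L)" "finite (arcs L)"
      using L pair_finite_verts pair_finite_arcs by (auto simp: subgraph_def intro: finite_subset)
    have "card (verts K) \<le> card (verts L)" "card (arcs K) \<le> card (arcs L)"
      using sub fin by (auto intro: card_mono)
    then have "card (verts K) = card (verts L)" "card (arcs K) = card (arcs L)"
      using le unfolding m_def by linarith+
    then have "verts K = verts L" "arcs K = arcs L"
      using sub fin by (simp_all add: card_subset_eq)
    moreover have "tail K = tail L" "head K = head L"
      using fst_snd[of K] fst_snd[of L] L K(1) by (auto simp: Q_def)
    ultimately show False using L by (auto intro: pre_digraph.equality)
  qed (use K(1) in \<open>auto simp: Q_def\<close>)
  then have "B \<in> blocks G" unfolding blocks_def using B by simp
  moreover have "verts H \<subseteq> pverts B" "arcs H \<subseteq> parcs B"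
    using K(1) by (auto simp: Q_def B_def subgraph_def)
  ultimately show ?thesis by blast
qed

text \<open>A single edge has no cut vertex, since deleting an end leaves one vertex. The degenerate
  case \<open>a = b\<close> puts every vertex into a block.\<close>

lemma (in pair_graph) edge_in_block:
  assumes ab: "(a, b) \<in> parcs G \<or> a = b \<and> a \<in> pverts G"
  shows "\<exists>B\<in>blocks G. {a, b} \<subseteq> pverts B \<and> (a \<noteq> b \<longrightarrow> (a, b) \<in> parcs B)"
proof -
  define H where "H = \<lparr>pverts = {a, b}, parcs = {(a, b), (b, a)} - Id\<rparr>"
  have H: "pair_graph H"
    by unfold_locales (auto simp: H_def symmetric_def sym_def)
  then interpret H: pair_graph H .
  have G: "a \<in> pverts G" "b \<in> pverts G" using ab in_arcsD1 in_arcsD2 by auto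
  have "subgraph (with_proj H) (with_proj G)"
    unfolding subgraph_def using G ab arcs_symmetric H.wf_digraph wf_digraph by (auto simp: H_def)
  moreover have "graph (with_proj H)" by (rule H.pair_graphD_graph)
  moreover have "connected (with_proj H)"
    unfolding connected_def
  proof (rule strongly_connectedI)
    \<comment> \<open>Connectedness is strong connectedness of the symmetric closure, and
      \<open>H\<close> is already symmetric.\<close>
    have mk: "mk_symmetric (with_proj H) = H"
      by (auto simp: mk_symmetric_def H_def)
    show "verts (with_proj (mk_symmetric (with_proj H))) \<noteq> {}"
      unfolding mk by (simp add: H_def)
    fix u v assume "u \<in> verts (with_proj (mk_symmetric (with_proj H)))"
      "v \<in> verts (with_proj (mk_symmetric (with_proj H)))"
    then have "u = v \<and> u \<in> pverts H \<or> (u, v) \<in> parcs H"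
      unfolding mk by (auto simp: H_def)
    then show "u \<rightarrow>\<^sup>*\<^bsub>with_proj (mk_symmetric (with_proj H))\<^esub> v"
      unfolding mk using H.reachable_refl H.reachable_adjI by auto
  qed
  moreover have "\<not> cut_vertex (with_proj H) v" for v
  proof
    assume "cut_vertex (with_proj H) v"
    then obtain u w where v: "v \<in> {a, b}" "u \<noteq> v" "w \<noteq> v" "u \<rightarrow>\<^sup>*\<^bsub>with_proj H\<^esub> w"
      and not: "\<not> reach_avoiding H v u w"
      unfolding cut_vertex_def reach_avoiding_def by (auto simp: H_def)
    have "u \<in> pverts H" "w \<in> pverts H"
      using v(4) by (auto elim: reachable_in_vertsE)
    then have "u \<in> {a, b}" "w \<in> {a, b}" by (simp_all add: H_def)
    then have "u = w" "u \<in> pverts H" using v by (auto simp: H_def)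
    then show False using not H.reach_avoiding_refl v by blast
  qed
  ultimately obtain B where "B \<in> blocks G" "verts (with_proj H) \<subseteq> pverts B" "arcs (with_proj H) \<subseteq> parcs B"
    using subgraph_in_block by blast
  then show ?thesis by (auto simp: H_def)
qed

text \<open>The vertex set of a cycle is given by the tails of its arcs; each head is the tail of
  the next arc, cyclically.\<close>

lemma (in pair_wf_digraph) cycle_wf:
  assumes "C \<in> cycles G"
  shows "wf_digraph (with_proj C)"
proof -
  obtain p u where p: "C = \<lparr>pverts = fst ` set p, parcs = set p \<union> (set p)\<inverse>\<rparr>" "pcas u p u"
    using assms by (auto simp: cycles_def cycle_def awalk_def)
  have "snd e \<in> fst ` set p" if e: "e \<in> set p" for e
  proof -
    obtain i where i: "i < length p" "e = p ! i" using e by (auto simp: in_set_conv_nth)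
    show ?thesis
    proof (cases "Suc i < length p")
      case True
      then have "snd e = fst (p ! Suc i)" using pcas_nth[OF p(2), of "Suc i"] i by simp
      then show ?thesis using True by simp
    next
      case False
      then have "i = length p - 1" "p \<noteq> []" using i by auto
      then have "snd e = u" using pcas_last[OF p(2)] i by (simp add: last_conv_nth)
      then have "snd e = fst (p ! 0)" using pcas_nth[OF p(2), of 0] \<open>p \<noteq> []\<close> by simp
      then show ?thesis using \<open>p \<noteq> []\<close> by simp
    qed
  qed
  then show ?thesis
    unfolding p(1) by unfold_locales force+
qed

text \<open>An infimum below 2 gives a walk of length less than 2, and since the ends differ it
  consists of exactly one arc.\<close>

lemma mu_eq_1_imp_adjacent:
  assumes wf: "wf_digraph (with_proj C)"
    and mu: "wf_digraph.\<mu> (with_proj C) (\<lambda>_. 1) u v = ereal (real 1)" and ne: "u \<noteq> v"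
  shows "(u, v) \<in> parcs C"
proof -
  interpret C: pair_wf_digraph C using wf by (simp add: wf_digraph_wp_iff)
  have "(INF p\<in>{p. C.awalk u p v}. ereal (C.awalk_cost (\<lambda>_. 1) p)) < 2"
    using mu by (simp add: C.\<mu>_def)
  then obtain p where p: "C.awalk u p v" "ereal (C.awalk_cost (\<lambda>_. 1) p) < 2"
    by (auto simp: INF_less_iff)
  have "C.awalk_cost (\<lambda>_. 1) p = real (length p)"
    by (induction p) auto
  then have "length p < 2" using p(2) by simp
  then show ?thesis
    using p(1) ne by (cases p) (auto simp: C.awalk_def)
qed

section \<open>Deriving the chain structure from cut vertices and blocks\<close>

locale ortho_chain_graph = pair_graph G for G :: "'a pair_pre_digraph" +
  fixes h n :: nat and C :: "nat \<Rightarrow> 'a pair_pre_digraph"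
  assumes h3: "3 \<le> h" and n2: "2 \<le> n"
    and blocks_cycles: "B \<in> blocks G \<Longrightarrow> B \<in> cycles G"
    and cut_two: "cut_vertex (with_proj G) v \<Longrightarrow> card {C \<in> cycles G. v \<in> pverts C} = 2"
    and card_cycle: "D \<in> cycles G \<Longrightarrow> card (pverts D) = h"
    and order: "chain_order n G C"
    and position: "i \<in> {2..n - 1} \<Longrightarrow> in_position 1 G (C i)"
begin

definition w :: "nat \<Rightarrow> 'a" where
  "w i = (SOME v. cut_vertex (with_proj G) v \<and> pverts (C i) \<inter> pverts (C (Suc i)) = {v})"

lemma w:
  assumes "1 \<le> i" "i < n"
  shows "cut_vertex (with_proj G) (w i)" "pverts (C i) \<inter> pverts (C (Suc i)) = {w i}"
proof -
  have "\<exists>v. cut_vertex (with_proj G) v \<and> pverts (C i) \<inter> pverts (C (Suc i)) = {v}"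
    using order assms by (auto simp: chain_order_def)
  from someI_ex[OF this] show "cut_vertex (with_proj G) (w i)"
    "pverts (C i) \<inter> pverts (C (Suc i)) = {w i}" by (auto simp: w_def)
qed

lemma bij_C: "bij_betw C {1..n} (cycles G)"
  using order unfolding chain_order_def by (rule conjunct1)

lemma C_cycle: "i \<in> {1..n} \<Longrightarrow> C i \<in> cycles G"
  by (rule bij_betw_apply[OF bij_C])

lemma cycle_C: "D \<in> cycles G \<Longrightarrow> \<exists>i\<in>{1..n}. D = C i"
  using bij_betw_imp_surj_on[OF bij_C] by blast

lemma C_inj: "i \<in> {1..n} \<Longrightarrow> j \<in> {1..n} \<Longrightarrow> C i = C j \<Longrightarrow> i = j"
  by (rule inj_onD[OF bij_betw_imp_inj_on[OF bij_C]])

text \<open>A third cycle through \<open>w i\<close> would contradict that a cut vertex lies in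
  exactly two cycles.\<close>

lemma w_mem_C:
  assumes i: "1 \<le> i" "i < n" and j: "j \<in> {1..n}" "w i \<in> pverts (C j)"
  shows "j = i \<or> j = Suc i"
proof (rule ccontr)
  assume "\<not> ?thesis"
  then have "C i \<noteq> C j" "C (Suc i) \<noteq> C j" "C i \<noteq> C (Suc i)"
    using C_inj[of i j] C_inj[of "Suc i" j] C_inj[of i "Suc i"] i j by auto
  then have "card {C i, C (Suc i), C j} = 3" by simp
  moreover have "{C i, C (Suc i), C j} \<subseteq> {D \<in> cycles G. w i \<in> pverts D}"
    using C_cycle[of i] C_cycle[of "Suc i"] C_cycle[of j] w(2)[OF i] i j by auto
  moreover have two: "card {D \<in> cycles G. w i \<in> pverts D} = 2"
    using cut_two[OF w(1)[OF i]] .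
  moreover have "finite {D \<in> cycles G. w i \<in> pverts D}"
    by (rule card_ge_0_finite) (simp add: two)
  ultimately show False
    using card_mono[of "{D \<in> cycles G. w i \<in> pverts D}" "{C i, C (Suc i), C j}"] by linarith
qed

lemma w_inj:
  assumes "1 \<le> i" "i < j" "j < n"
  shows "w i \<noteq> w j"
proof
  assume "w i = w j"
  then have "w i \<in> pverts (C (Suc j))" using w(2)[of j] assms by auto
  then show False using w_mem_C[of i "Suc j"] assms by auto
qed

lemma vertex_in_cycle: "v \<in> pverts G \<Longrightarrow> \<exists>i\<in>{1..n}. v \<in> pverts (C i)"
  using edge_in_block[of v v] blocks_cycles cycle_C by blast

lemma edge_in_cycle: "(a, b) \<in> parcs G \<Longrightarrow> \<exists>i\<in>{1..n}. (a, b) \<in> parcs (C i) \<and> a \<in> pverts (C i) \<and> b \<in> pverts (C i)"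
  using edge_in_block[of a b] no_loops'[of a b] blocks_cycles cycle_C by blast

text \<open>One walks from cycle \<open>j\<close> up to cycle \<open>i\<close> through the
  successive cut vertices, all different from \<open>w i\<close>; within each cycle
  \<open>w i\<close> can be avoided.\<close>

lemma left_part_connected:
  assumes i: "i < n" and j: "1 \<le> j" "j \<le> i"
    and a: "a \<in> pverts (C j)" "a \<noteq> w i" and b: "b \<in> pverts (C i)" "b \<noteq> w i"
  shows "reach_avoiding G (w i) a b"
  using j(2,1) a
proof (induction j arbitrary: a rule: inc_induct)
  case base
  then show ?case using cycle_reach_avoiding[OF C_cycle[of i]] i b by auto
next
  case (step j)
  have wj: "w j \<in> pverts (C j)" "w j \<in> pverts (C (Suc j))" "w j \<noteq> w i"
    using w(2)[of j] w_inj[of j i] step i by auto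
  have "reach_avoiding G (w i) a (w j)"
    using cycle_reach_avoiding[OF C_cycle[of j]] step wj i by auto
  moreover have "reach_avoiding G (w i) (w j) b"
    using step wj by auto
  ultimately show ?case by (rule reach_avoiding_trans)
qed

lemma right_part_connected:
  assumes i: "1 \<le> i" and j: "Suc i \<le> j" "j \<le> n"
    and a: "a \<in> pverts (C j)" "a \<noteq> w i" and b: "b \<in> pverts (C (Suc i))" "b \<noteq> w i"
  shows "reach_avoiding G (w i) a b"
  using j a
proof (induction j arbitrary: a rule: dec_induct)
  case base
  then show ?case using cycle_reach_avoiding[OF C_cycle[of "Suc i"]] i b by auto
next
  case (step j)
  have wj: "w j \<in> pverts (C j)" "w j \<in> pverts (C (Suc j))" "w j \<noteq> w i"
    using w(2)[of j] w_inj[of i j] step i by auto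
  have "reach_avoiding G (w i) a (w j)"
    using cycle_reach_avoiding[OF C_cycle[of "Suc j"]] step wj i by auto
  moreover have "reach_avoiding G (w i) (w j) b"
    using step wj by auto
  ultimately show ?case by (rule reach_avoiding_trans)
qed

text \<open>Another common vertex would reconnect both sides, so that \<open>w i\<close> would not be a cut vertex.\<close>

lemma cycles_Int_subset:
  assumes i: "1 \<le> k" "k \<le> i" "i < l" "l \<le> n"
  shows "pverts (C k) \<inter> pverts (C l) \<subseteq> {w i}"
proof
  fix x assume x: "x \<in> pverts (C k) \<inter> pverts (C l)"
  show "x \<in> {w i}"
  proof (rule ccontr)
    assume "x \<notin> {w i}"
    then have xw: "x \<noteq> w i" by simp
    have other: "\<exists>b. b \<in> pverts (C j) \<and> b \<noteq> w i" if "j \<in> {1..n}" for j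
    proof (rule ccontr)
      assume "\<not> ?thesis"
      then have "pverts (C j) \<subseteq> {w i}" by auto
      then have "card (pverts (C j)) \<le> card {w i}" by (intro card_mono) auto
      then show False using card_cycle[OF C_cycle[OF that]] h3 by simp
    qed
    obtain b c where b: "b \<in> pverts (C i)" "b \<noteq> w i" and c: "c \<in> pverts (C (Suc i))" "c \<noteq> w i"
      using other[of i] other[of "Suc i"] i by auto
    \<comment> \<open>As \<open>x\<close> lies in a cycle on either side of \<open>w i\<close>,
      every other vertex reaches \<open>x\<close> within its own side.\<close>
    have all: "reach_avoiding G (w i) a x" if a: "a \<in> pverts G" "a \<noteq> w i" for a
    proof -
      obtain j where j: "j \<in> {1..n}" "a \<in> pverts (C j)" using vertex_in_cycle a by blast
      show ?thesis
      proof (cases "j \<le> i")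
        case True
        have "reach_avoiding G (w i) a b" "reach_avoiding G (w i) x b"
          using left_part_connected[of i j a b] left_part_connected[of i k x b] i j a b x xw True by auto
        then show ?thesis using reach_avoiding_sym reach_avoiding_trans by metis
      next
        case False
        have "reach_avoiding G (w i) a c" "reach_avoiding G (w i) x c"
          using right_part_connected[of i j a c] right_part_connected[of i l x c] i j a c x xw False by auto
        then show ?thesis using reach_avoiding_sym reach_avoiding_trans by metis
      qed
    qed
    have "cut_vertex (with_proj G) (w i)" using w(1) i by auto
    then obtain a b where ab: "a \<noteq> w i" "b \<noteq> w i" "a \<rightarrow>\<^sup>*\<^bsub>with_proj G\<^esub> b" "\<not> reach_avoiding G (w i) a b"
      unfolding cut_vertex_def reach_avoiding_def by auto
    have "a \<in> pverts G" "b \<in> pverts G"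
      using ab(3) by (auto elim: reachable_in_vertsE)
    then show False
      using all[of a] all[of b] ab reach_avoiding_sym reach_avoiding_trans by metis
  qed
qed

lemma cycles_Int_le1:
  assumes "k \<in> {1..n}" "l \<in> {1..n}" "k \<noteq> l" "a \<in> pverts (C k) \<inter> pverts (C l)" "b \<in> pverts (C k) \<inter> pverts (C l)"
  shows "a = b"
proof (cases "k < l")
  case True
  then show ?thesis using cycles_Int_subset[of k k l] assms by auto
next
  case False
  then show ?thesis using cycles_Int_subset[of l l k] assms by auto
qed

text \<open>Cycles have no chords: an arc of \<open>G\<close> lies in some cycle, and two cycles
  sharing both of its ends coincide.\<close>

lemma parcs_C:
  assumes i: "i \<in> {1..n}" and ab: "a \<in> pverts (C i)" "b \<in> pverts (C i)"
  shows "(a, b) \<in> parcs (C i) \<longleftrightarrow> (a, b) \<in> parcs G"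
proof
  assume "(a, b) \<in> parcs (C i)"
  then show "(a, b) \<in> parcs G" using cycles_subset(3)[OF C_cycle[OF i]] arcs_symmetric by blast
next
  assume G: "(a, b) \<in> parcs G"
  then obtain j where j: "j \<in> {1..n}" "(a, b) \<in> parcs (C j)" "a \<in> pverts (C j)" "b \<in> pverts (C j)"
    using edge_in_cycle by blast
  have "i = j"
    using cycles_Int_le1[of i j a b] i j ab no_loops'[OF G] by auto
  then show "(a, b) \<in> parcs (C i)" using j by simp
qed

text \<open>Both \<open>w (i - 1)\<close> and \<open>w i\<close> are cut vertices on cycle
  \<open>i\<close> and they differ, so they are the two vertices at distance 1, in some
  order.\<close>

lemma ortho:
  assumes "2 \<le> i" "i < n"
  shows "(w (i - 1), w i) \<in> parcs G"
proof -
  obtain u v where uv: "u \<noteq> v" "cut_vertices_on G (C i) = {u, v}"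
    "wf_digraph.\<mu> (with_proj (C i)) (\<lambda>_. 1) u v = ereal (real 1)"
    using position[of i, unfolded in_position_def] assms by fastforce
  have i: "i \<in> {1..n}" using assms by simp
  have wf: "wf_digraph (with_proj (C i))"
    using cycle_wf[OF C_cycle[OF i]] .
  have C: "pverts (C (i - 1)) \<inter> pverts (C i) = {w (i - 1)}" "pverts (C i) \<inter> pverts (C (Suc i)) = {w i}"
    using w(2)[of "i - 1"] w(2)[of i] assms by auto
  have cut: "cut_vertex (with_proj G) (w (i - 1))" "cut_vertex (with_proj G) (w i)"
    using w(1)[of "i - 1"] w(1)[of i] assms by auto
  have "{w (i - 1), w i} \<subseteq> {u, v}"
    unfolding uv(2)[symmetric] cut_vertices_on_def using C cut by auto
  moreover have "w (i - 1) \<noteq> w i" using w_inj[of "i - 1" i] assms by auto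
  moreover have "(u, v) \<in> parcs (C i)" by (rule mu_eq_1_imp_adjacent[OF wf uv(3,1)])
  then have "(u, v) \<in> parcs G" "(v, u) \<in> parcs G"
    using cycles_subset(3)[OF C_cycle[OF i]] arcs_symmetric by blast+
  ultimately show ?thesis by auto
qed

sublocale chain: ortho_chain_structure "parcs G" h n "\<lambda>i. pverts (C i)" w
proof unfold_locales
  show "3 \<le> h" "2 \<le> n" by (fact h3 n2)+
  show "sym (parcs G)" using arcs_symmetric by (auto intro: symI)
  show "irrefl (parcs G)" using no_loops' by (auto simp: irrefl_def)
  fix i :: nat
  show "\<exists>f. cyclic_enum (parcs G) (pverts (C i)) h f" if i: "i \<in> {1..n}"
  proof -
    obtain f where f: "cyclic_enum (parcs (C i)) (pverts (C i)) h f"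
      using cycle_enum[OF C_cycle[OF i]] card_cycle[OF C_cycle[OF i]] by metis
    then have "f j \<in> pverts (C i)" for j by (auto simp: cyclic_enum_def)
    then have "cyclic_enum (parcs G) (pverts (C i)) h f"
      using f parcs_C[OF i] unfolding cyclic_enum_def by simp
    then show ?thesis by blast
  qed
  show "pverts (C i) \<inter> pverts (C (Suc i)) = {w i}" if "1 \<le> i" "i < n"
    using w(2) that by simp
  \<comment> \<open>Both \<open>w i\<close> and \<open>w (Suc i)\<close> separate the two cycles, so
    a common vertex would equal each of these distinct vertices.\<close>
  show "pverts (C i) \<inter> pverts (C j) = {}" if "1 \<le> i" "Suc i < j" "j \<le> n" for j
    using cycles_Int_subset[of i i j] cycles_Int_subset[of i "Suc i" j] w_inj[of i "Suc i"] that by auto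
  show "\<exists>i\<in>{1..n}. x \<in> pverts (C i) \<and> y \<in> pverts (C i)" if "(x, y) \<in> parcs G" for x y
    using edge_in_cycle[OF that] by blast
  show "(w (i - 1), w i) \<in> parcs G" if "2 \<le> i" "i < n"
    using ortho that by simp
qed

lemma initial_n: "chain.initial n = pverts G"
  using vertex_in_cycle cycles_subset(1)[OF C_cycle] unfolding chain.initial_def by blast

end

text \<open>A positive count shows that the bound \<open>d\<close> is attained, which identifies it
  as the independence number.\<close>

lemma max_independent_sets:
  assumes "top_count {S. independent_set G S} d c" "0 < c"
  shows "num_independent_sets (independence_number G) G = c"
proof -
  have fin: "finite {S. independent_set G S}" and le: "\<And>S. independent_set G S \<Longrightarrow> card S \<le> d"
    and c: "card {S. independent_set G S \<and> card S = d} = c"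
    using assms by (auto simp: top_count_def)
  have "{S. independent_set G S \<and> card S = d} \<noteq> {}"
    using c assms(2) by (metis card.empty less_irrefl)
  then obtain S where "independent_set G S" "card S = d" by blast
  then have "independence_number G = d"
    unfolding independence_number_def using fin le by (intro Max_eqI) auto
  then show ?thesis using c by (simp add: num_independent_sets_def)
qed

theorem theorem5:
  fixes h n :: nat and G :: "'a pair_pre_digraph"
  assumes "h \<ge> 3" and "n \<ge> 2" and "ortho_chain h n G"
  shows "(\<forall>k. even h \<and> n = 2 * k \<longrightarrow>
             num_independent_sets (independence_number G) G = 1) \<and>
         (\<forall>k. even h \<and> n = 2 * k + 1 \<longrightarrow>
             real (num_independent_sets (independence_number G) G) = 2 + real k * real h / 2) \<and>
         (odd h \<longrightarrow>
             real (num_independent_sets (independence_number G) G) = ((real h + 1) / 2)\<^sup>2)"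
proof -
  obtain C where "chain_order n G C" "\<forall>i\<in>{2..n - 1}. in_position 1 G (C i)"
    using assms(3) by (auto simp: ortho_chain_def)
  moreover have "pair_graph G"
    using assms(3) by (auto simp: ortho_chain_def chain_h_cactus_def chain_cactus_def cactus_def)
  ultimately interpret ortho_chain_graph G h n C
    using assms unfolding ortho_chain_graph_def ortho_chain_graph_axioms_def
    by (auto simp: ortho_chain_def chain_h_cactus_def chain_cactus_def)
  have "{S. S \<subseteq> chain.initial n \<and> indep (parcs G) S} = {S. independent_set G S}"
    by (auto simp: initial_n independent_set_def indep_def)
  then obtain d where "top_count {S. independent_set G S} d
      (if odd h then ((h + 1) div 2)\<^sup>2 else if even n then 1 else 2 + n div 2 * (h div 2))"
    using chain.top_count_chain by metis
  then have count: "num_independent_sets (independence_number G) G =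
      (if odd h then ((h + 1) div 2)\<^sup>2 else if even n then 1 else 2 + n div 2 * (h div 2))"
    by (rule max_independent_sets) (use assms(1) in auto)
  show ?thesis
  proof (intro conjI allI impI)
    show "num_independent_sets (independence_number G) G = 1" if "even h \<and> n = 2 * k" for k
      using that count by simp
    show "real (num_independent_sets (independence_number G) G) = 2 + real k * real h / 2"
      if "even h \<and> n = 2 * k + 1" for k
      using that unfolding count by (auto elim!: evenE)
    show "real (num_independent_sets (independence_number G) G) = ((real h + 1) / 2)\<^sup>2" if "odd h"
      using that unfolding count by (auto elim!: oddE simp: power2_eq_square field_simps)
  qed
qed

end
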